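(* Let either $1<p<N$ and $p<q<s\le p^*:=Np/(N-p)$, or $p=N\ge 2$ and $p<q<s<\infty$. Assume there are constants $\rho_0>0$ and $\gamma>p-1$ such that $\rho(x)\ge \rho_0(1+x_N)^\gamma$ for a.e. $x\in\mathbb{R}^N_+$. Suppose that $b\in\mathcal{K}_b$, let $b_0>0$ be a constant such that $b(x)(1+x_N)^{p-\gamma}\le b_0$ in $\mathbb{R}^N_+$, and suppose that $a/b\in L^\infty(\mathbb{R}^N_+)$ with $$\left\|\frac{a}{b}\right\|_{\infty}^{s-p}\left(\frac{b_0\,C_{p,\gamma}^{-p}}{\rho_0}\right)^{s-q}<\frac{(s-p)^{s-p}}{(q-p)^{q-p}(s-q)^{s-q}},\qquad C_{p,\gamma}=\frac{\gamma-p+1}{p}.$$ Then the problem $$-\mathrm{div}(\rho(x)|\nabla u|^{p-2}\nabla u)=a(x)|u|^{q-2}u-b(x)|u|^{s-2}u \ \text{ in } \mathbb{R}^N_+,\qquad |\nabla u|^{p-2}\nabla u\cdot\nu=0\ \text{ on } \mathbb{R}^{N-1},$$ possesses only the trivial weak solution $u=0$ in $E$.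
   Context: $\mathbb{R}^N_+=\{(x',x_N): x'\in\mathbb{R}^{N-1},\ x_N>0\}$, with boundary identified with $\mathbb{R}^{N-1}$ and unit outer normal $\nu$. The functions $\rho,a,b$ are positive and integrable on every bounded subset of $\mathbb{R}^N_+$. $C_\delta^\infty(\mathbb{R}^N_+)$ is the set of restrictions to $\mathbb{R}^N_+$ of functions in $C_0^\infty(\mathbb{R}^N)$ (smooth, compactly supported). $E$ is the completion (closure) of $C_\delta^\infty(\mathbb{R}^N_+)$ with respect to $\|u\|=\left(\int_{\mathbb{R}^N_+}\rho|\nabla u|^p\,dx\right)^{1/p}$; under the lower bound on $\rho$ it is identified with a space of weakly differentiable functions in $L^p(\mathbb{R}^N_+,(1+x_N)^{\gamma-p}dx)$. $\mathcal{K}_b=\{k\in C(\overline{\mathbb{R}^N_+},(0,\infty)): k(x)(1+x_N)^{p-\gamma}\in L^\infty(\mathbb{R}^N_+)\}$. A weak solution of the problem is a function $u\in E$ such that $$\int_{\mathbb{R}^N_+}\rho|\nabla u|^{p-2}\nabla u\cdot\nabla\varphi\,dx=\int_{\mathbb{R}^N_+}\left(a|u|^{q-2}u-b|u|^{s-2}u\right)\varphi\,dx\quad\text{for every }\varphi\in C_\delta^\infty(\mathbb{R}^N_+).$$ *)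

theory Defs
  imports "HOL-Analysis.Analysis" "HOL-Probability.Essential_Supremum"
begin

text \<open>A point of \<open>R^N\<close> is written \<open>(x', x_N)\<close> with \<open>x'\<close> in \<open>R^(N-1)\<close>; hence
  \<open>N = CARD('m) + 1\<close>, and \<open>N\<close> ranges over all integers \<open>\<ge> 2\<close> as \<open>'m\<close> varies.\<close>

type_synonym 'm space_N = "(real ^ 'm) \<times> real"

definition half_space :: "('m::finite) space_N set" where
  "half_space = {x. 0 < snd x}"

abbreviation half_measure :: "('m::finite) space_N measure" where
  "half_measure \<equiv> lebesgue_on half_space"

definition grad :: "('a::euclidean_space \<Rightarrow> real) \<Rightarrow> 'a \<Rightarrow> 'a" where
  "grad f x = (\<Sum>i\<in>Basis. frechet_derivative f (at x) i *\<^sub>R i)"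

fun times_cont_differentiable :: "nat \<Rightarrow> ('a::euclidean_space \<Rightarrow> real) \<Rightarrow> bool" where
  "times_cont_differentiable 0 f \<longleftrightarrow> continuous_on UNIV f"
| "times_cont_differentiable (Suc k) f \<longleftrightarrow>
     (\<forall>x. f differentiable (at x)) \<and>
     (\<forall>i\<in>Basis. times_cont_differentiable k (\<lambda>x. frechet_derivative f (at x) i))"

text \<open>\<open>C_0^\<infinity>(\<Omega>)\<close> for open \<open>\<Omega>\<close>, each function being extended by zero to the whole space.\<close>

definition test_functions :: "'a::euclidean_space set \<Rightarrow> ('a \<Rightarrow> real) set" where
  "test_functions \<Omega> =
     {\<phi>. (\<forall>k. times_cont_differentiable k \<phi>) \<and>
         compact (closure {x. \<phi> x \<noteq> 0}) \<and> closure {x. \<phi> x \<noteq> 0} \<subseteq> \<Omega>}"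

text \<open>\<open>C_\<delta>^\<infinity>\<close>: an element is given by a function on the whole of \<open>R^N\<close>; only its
  restriction to the half space is ever used below, as all integrals are over the half space.\<close>

abbreviation C_delta :: "(('m::finite) space_N \<Rightarrow> real) set" where
  "C_delta \<equiv> test_functions UNIV"

definition locally_integrable_on ::
    "'a::euclidean_space set \<Rightarrow> ('a \<Rightarrow> 'b::euclidean_space) \<Rightarrow> bool" where
  "locally_integrable_on \<Omega> f \<longleftrightarrow> (\<forall>K. compact K \<and> K \<subseteq> \<Omega> \<longrightarrow> set_integrable lebesgue K f)"

definition has_weak_gradient ::
    "(('m::finite) space_N \<Rightarrow> real) \<Rightarrow> ('m space_N \<Rightarrow> 'm space_N) \<Rightarrow> bool" where
  "has_weak_gradient u G \<longleftrightarrow>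
     locally_integrable_on half_space u \<and> locally_integrable_on half_space G \<and>
     (\<forall>\<phi>\<in>test_functions half_space. \<forall>i\<in>Basis.
        (\<integral>x. u x * (grad \<phi> x \<bullet> i) \<partial>half_measure) = - (\<integral>x. (G x \<bullet> i) * \<phi> x \<partial>half_measure))"

definition Lp_weighted ::
    "real \<Rightarrow> (('m::finite) space_N \<Rightarrow> real) \<Rightarrow> ('m space_N \<Rightarrow> 'b::euclidean_space) set" where
  "Lp_weighted p w =
     {f \<in> borel_measurable half_measure. integrable half_measure (\<lambda>x. w x * norm (f x) powr p)}"

definition Lp_norm ::
    "real \<Rightarrow> (('m::finite) space_N \<Rightarrow> real) \<Rightarrow> ('m space_N \<Rightarrow> 'b::euclidean_space) \<Rightarrow> real" where
  "Lp_norm p w f = (\<integral>x. w x * norm (f x) powr p \<partial>half_measure) powr (1 / p)"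

text \<open>\<open>in_E_with_gradient p \<gamma> \<rho> u G\<close>: the function \<open>u\<close> lies in \<open>E\<close> and its weak gradient is \<open>G\<close>.
  An element of the abstract completion is a Cauchy sequence \<open>\<phi>\<^sub>n\<close> in \<open>C_\<delta>^\<infinity>\<close> for the norm
  \<open>Lp_norm p \<rho> (grad \<phi>)\<close>. When \<open>\<rho> \<ge> \<rho>0 (1 + x_N)^\<gamma>\<close> with \<open>\<rho>0 > 0\<close> and \<open>\<gamma> > p - 1\<close>, Hardy's
  inequality makes \<open>\<phi>\<^sub>n\<close> converge in the weighted space \<open>L^p((1 + x_N)^(\<gamma> - p) dx)\<close> to some \<open>u\<close>,
  the gradients converge in \<open>L^p(\<rho> dx)\<close> to the weak gradient of \<open>u\<close>, and \<open>u\<close> determines the element.\<close>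

definition in_E_with_gradient ::
    "real \<Rightarrow> real \<Rightarrow> (('m::finite) space_N \<Rightarrow> real) \<Rightarrow>
     ('m space_N \<Rightarrow> real) \<Rightarrow> ('m space_N \<Rightarrow> 'm space_N) \<Rightarrow> bool" where
  "in_E_with_gradient p \<gamma> \<rho> u G \<longleftrightarrow>
     u \<in> Lp_weighted p (\<lambda>x. (1 + snd x) powr (\<gamma> - p)) \<and>
     G \<in> Lp_weighted p \<rho> \<and>
     has_weak_gradient u G \<and>
     (\<exists>\<phi>. (\<forall>n::nat. \<phi> n \<in> C_delta) \<and>
        (\<lambda>n. Lp_norm p (\<lambda>x. (1 + snd x) powr (\<gamma> - p)) (\<lambda>x. \<phi> n x - u x)) \<longlonglongrightarrow> 0 \<and>
        (\<lambda>n. Lp_norm p \<rho> (\<lambda>x. grad (\<phi> n) x - G x)) \<longlonglongrightarrow> 0)"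

text \<open>Both integrals in the weak formulation are required to exist as Lebesgue integrals (the
  Bochner integral of a non-integrable function is \<open>0\<close> by convention).
  At zeros of \<open>u\<close> and \<open>G\<close> the terms \<open>|u|^(q-2) u\<close> and \<open>|G|^(p-2) G\<close> are \<open>0\<close>.\<close>

definition weak_solution ::
    "real \<Rightarrow> real \<Rightarrow> real \<Rightarrow> real \<Rightarrow>
     (('m::finite) space_N \<Rightarrow> real) \<Rightarrow> ('m space_N \<Rightarrow> real) \<Rightarrow> ('m space_N \<Rightarrow> real) \<Rightarrow>
     ('m space_N \<Rightarrow> real) \<Rightarrow> bool" where
  "weak_solution p q s \<gamma> \<rho> a b u \<longleftrightarrow>
     (\<exists>G. in_E_with_gradient p \<gamma> \<rho> u G \<and>
        (\<forall>\<phi>\<in>C_delta.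
           integrable half_measure
             (\<lambda>x. \<rho> x * norm (G x) powr (p - 2) * (G x \<bullet> grad \<phi> x)) \<and>
           integrable half_measure
             (\<lambda>x. (a x * \<bar>u x\<bar> powr (q - 2) * u x - b x * \<bar>u x\<bar> powr (s - 2) * u x) * \<phi> x) \<and>
           (\<integral>x. \<rho> x * norm (G x) powr (p - 2) * (G x \<bullet> grad \<phi> x) \<partial>half_measure) =
           (\<integral>x. (a x * \<bar>u x\<bar> powr (q - 2) * u x - b x * \<bar>u x\<bar> powr (s - 2) * u x) * \<phi> x
              \<partial>half_measure)))"

definition admissible_weight :: "(('m::finite) space_N \<Rightarrow> real) \<Rightarrow> bool" where
  "admissible_weight f \<longleftrightarrow>
     (\<forall>x\<in>half_space. 0 < f x) \<and>
     (\<forall>S\<in>sets lebesgue. bounded S \<and> S \<subseteq> half_space \<longrightarrow> set_integrable lebesgue S f)"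

text \<open>The essential supremum is taken in the extended reals, where it always exists.\<close>

definition Linf :: "(('m::finite) space_N \<Rightarrow> real) set" where
  "Linf = {f \<in> borel_measurable half_measure. esssup half_measure (\<lambda>x. ereal \<bar>f x\<bar>) < \<infinity>}"

definition Linf_norm :: "(('m::finite) space_N \<Rightarrow> real) \<Rightarrow> real" where
  "Linf_norm f = real_of_ereal (esssup half_measure (\<lambda>x. ereal \<bar>f x\<bar>))"

definition K_b :: "real \<Rightarrow> real \<Rightarrow> (('m::finite) space_N \<Rightarrow> real) set" where
  "K_b p \<gamma> =
     {k. continuous_on (closure half_space) k \<and> (\<forall>x\<in>closure half_space. 0 < k x) \<and>
         (\<lambda>x. k x * (1 + snd x) powr (p - \<gamma>)) \<in> Linf}"

definition hardy_const :: "real \<Rightarrow> real \<Rightarrow> real" where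
  "hardy_const p \<gamma> = (\<gamma> - p + 1) / p"

end

theory Submission
  imports Defs
begin

text \<open>
  Formally, testing the equation with \<open>u\<close> itself gives
  \<open>\<integral>\<rho>|\<nabla>u|\<^sup>p = \<integral>(a|u|\<^sup>q - b|u|\<^sup>s) \<le> \<mu> b\<^sub>0 \<integral>(1+x\<^sub>N) powr (\<gamma>-p) |u|\<^sup>p\<close>, where \<open>\<mu>\<close> is the maximum of
  \<open>|a/b| t powr (q-p) - t powr (s-p)\<close> over \<open>t \<ge> 0\<close>. Hardy's inequality bounds the right-hand side by
  \<open>\<mu> b\<^sub>0 C powr (-p) / \<rho>\<^sub>0 \<integral>\<rho>|\<nabla>u|\<^sup>p\<close>, and the smallness condition says exactly that this
  factor is less than \<open>1\<close>.

  Only smooth compactly supported test functions are allowed, and nothing is known about the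
  integrability of \<open>b|u|\<^sup>s\<close>. With \<open>\<phi>\<^sub>n \<rightarrow> u\<close> in \<open>E\<close> and \<open>H s t = 2st\<^sup>2/(s\<^sup>2+t\<^sup>2+\<epsilon>)\<close>, the test functions
  \<open>H \<phi>\<^sub>m \<phi>\<^sub>n\<close> serve instead: \<open>|H s t| \<le> |t|\<close> allows \<open>m \<rightarrow> \<infinity>\<close> for fixed \<open>n\<close>, and since
  \<open>H u \<phi>\<^sub>n\<close> has the sign of \<open>u\<close>, the pointwise upper bound for \<open>a|u|\<^sup>q - b|u|\<^sup>s\<close> suffices for the limits
  \<open>n \<rightarrow> \<infinity>\<close> and then \<open>\<epsilon> \<rightarrow> 0\<close>. No Sobolev embedding is needed. The last limit yields the gradient
  integral over \<open>{u \<noteq> 0}\<close> only, and Hardy's inequality is proved with the same restriction.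
\<close>

section \<open>Smooth test functions\<close>

lemma times_cont_differentiable_Suc:
  "times_cont_differentiable (Suc k) f \<Longrightarrow> times_cont_differentiable k f"
proof (induction k arbitrary: f)
  case 0
  then show ?case
    by (auto simp: continuous_on_eq_continuous_at differentiable_imp_continuous_within)
qed simp

lemma times_cont_differentiable_const: "times_cont_differentiable k (\<lambda>x. c)"
  by (induction k arbitrary: c) simp_all

lemma times_cont_differentiable_add:
  assumes "times_cont_differentiable k f" "times_cont_differentiable k g"
  shows "times_cont_differentiable k (\<lambda>x. f x + g x)"
  using assms
proof (induction k arbitrary: f g)
  case (Suc k)
  have "frechet_derivative (\<lambda>x. f x + g x) (at x) =
      (\<lambda>h. frechet_derivative f (at x) h + frechet_derivative g (at x) h)" for x
    using Suc.prems
    by (intro frechet_derivative_at[symmetric] has_derivative_add) (auto simp: frechet_derivative_works[symmetric])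
  then show ?case
    using Suc by simp
qed (auto intro: continuous_intros)

lemma times_cont_differentiable_mult:
  assumes "times_cont_differentiable k f" "times_cont_differentiable k g"
  shows "times_cont_differentiable k (\<lambda>x. f x * g x)"
  using assms
proof (induction k arbitrary: f g)
  case (Suc k)
  have "frechet_derivative (\<lambda>x. f x * g x) (at x) =
      (\<lambda>h. f x * frechet_derivative g (at x) h + frechet_derivative f (at x) h * g x)" for x
    using Suc.prems
    by (intro frechet_derivative_at[symmetric] has_derivative_mult) (auto simp: frechet_derivative_works[symmetric])
  then show ?case
    using Suc times_cont_differentiable_Suc[OF Suc.prems(1)] times_cont_differentiable_Suc[OF Suc.prems(2)]
    by (auto intro!: times_cont_differentiable_add)
qed (auto intro: continuous_intros)

lemma times_cont_differentiable_inverse: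
  assumes "times_cont_differentiable k f" "\<And>x. f x \<noteq> 0"
  shows "times_cont_differentiable k (\<lambda>x. inverse (f x))"
  using assms
proof (induction k arbitrary: f)
  case (Suc k)
  \<comment> \<open>The factor \<open>- 1\<close> and the bracketing exhibit the derivative as a
    product of a constant, two reciprocals of \<open>f\<close> and a partial derivative of
    \<open>f\<close>, so the induction hypothesis for \<open>f\<close> itself and closure under
    products settle order \<open>k\<close>.\<close>
  have "frechet_derivative (\<lambda>x. inverse (f x)) (at x) =
      (\<lambda>h. - 1 * (inverse (f x) * (frechet_derivative f (at x) h * inverse (f x))))" for x
  proof (rule frechet_derivative_at[symmetric])
    have "((\<lambda>x. inverse (f x)) has_derivative
      (\<lambda>h. - (inverse (f x) * frechet_derivative f (at x) h * inverse (f x)))) (at x)"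
      using Suc.prems by (intro Deriv.has_derivative_inverse) (auto simp: frechet_derivative_works[symmetric])
    then show "((\<lambda>x. inverse (f x)) has_derivative
      (\<lambda>h. - 1 * (inverse (f x) * (frechet_derivative f (at x) h * inverse (f x))))) (at x)"
      by (simp add: mult.assoc)
  qed
  moreover have "times_cont_differentiable k (\<lambda>x. - 1 *
      (inverse (f x) * (frechet_derivative f (at x) i * inverse (f x))))" if "i \<in> Basis" for i
    using Suc.IH[of f] Suc.prems times_cont_differentiable_Suc[OF Suc.prems(1)] that
    by (intro times_cont_differentiable_mult times_cont_differentiable_const) auto
  moreover have "(\<lambda>x. inverse (f x)) differentiable (at x)" for x
    using Suc.prems by (intro differentiable_inverse) auto
  ultimately show ?case
    by simp
qed (auto intro!: continuous_intros)

text \<open>\<open>compromise \<epsilon> s t\<close> has the sign of \<open>s\<close>, is bounded by \<open>\<bar>t\<bar>\<close>, and tends to \<open>s\<close> when \<open>t = s\<close> and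
  \<open>\<epsilon> \<rightarrow> 0\<close>; being rational, it is smooth. \<open>compromise_s\<close> and \<open>compromise_t\<close> are its partial derivatives.\<close>

definition compromise :: "real \<Rightarrow> real \<Rightarrow> real \<Rightarrow> real" where
  "compromise \<epsilon> s t = 2 * s * t\<^sup>2 / (s\<^sup>2 + t\<^sup>2 + \<epsilon>)"

definition compromise_s :: "real \<Rightarrow> real \<Rightarrow> real \<Rightarrow> real" where
  "compromise_s \<epsilon> s t = 2 * t\<^sup>2 * (t\<^sup>2 + \<epsilon> - s\<^sup>2) / (s\<^sup>2 + t\<^sup>2 + \<epsilon>)\<^sup>2"

definition compromise_t :: "real \<Rightarrow> real \<Rightarrow> real \<Rightarrow> real" where
  "compromise_t \<epsilon> s t = 4 * s * t * (s\<^sup>2 + \<epsilon>) / (s\<^sup>2 + t\<^sup>2 + \<epsilon>)\<^sup>2"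

section \<open>Uniform bounds for the compromise function\<close>

lemma denominator_pos: "0 < \<epsilon> \<Longrightarrow> 0 < s\<^sup>2 + t\<^sup>2 + (\<epsilon>::real)"
  by (simp add: add_nonneg_pos)

text \<open>Each of the factors \<open>t\<^sup>2\<close> and
  \<open>\<bar>t\<^sup>2 + \<epsilon> - s\<^sup>2\<bar>\<close> is at most the denominator. A bound
  free of \<open>\<epsilon>\<close>, \<open>s\<close> and \<open>t\<close> lets multiples of one
  function dominate the gradient integrals in all three limits.\<close>

lemma abs_compromise_s_le:
  assumes "0 < \<epsilon>" shows "\<bar>compromise_s \<epsilon> s t\<bar> \<le> 2"
proof -
  define D where "D = s\<^sup>2 + t\<^sup>2 + \<epsilon>"
  have D: "0 < D" using denominator_pos[OF assms] by (simp add: D_def)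
  have "t\<^sup>2 * \<bar>t\<^sup>2 + \<epsilon> - s\<^sup>2\<bar> \<le> D * D"
    using assms D unfolding D_def by (intro mult_mono) (auto simp: abs_le_iff)
  then have "\<bar>2 * t\<^sup>2 * (t\<^sup>2 + \<epsilon> - s\<^sup>2)\<bar> \<le> 2 * D\<^sup>2"
    by (simp add: abs_mult power2_eq_square)
  then show ?thesis
    using D unfolding compromise_s_def D_def[symmetric]
    by (simp only: abs_divide) (simp add: divide_simps)
qed

lemma two_mult_le_denominator: "0 < \<epsilon> \<Longrightarrow> 2 * \<bar>s * t\<bar> \<le> s\<^sup>2 + t\<^sup>2 + (\<epsilon>::real)"
  using zero_le_power2[of "\<bar>s\<bar> - \<bar>t\<bar>"] by (simp add: power2_diff abs_mult)

lemma abs_compromise_t_le: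
  assumes "0 < \<epsilon>" shows "\<bar>compromise_t \<epsilon> s t\<bar> \<le> 2"
proof -
  define D where "D = s\<^sup>2 + t\<^sup>2 + \<epsilon>"
  have D: "0 < D" using denominator_pos[OF assms] by (simp add: D_def)
  have "(2 * \<bar>s * t\<bar>) * \<bar>s\<^sup>2 + \<epsilon>\<bar> \<le> D * D"
    using assms D two_mult_le_denominator[OF assms, of s t] unfolding D_def by (intro mult_mono) auto
  then have "\<bar>4 * s * t * (s\<^sup>2 + \<epsilon>)\<bar> \<le> 2 * D\<^sup>2"
    by (simp add: abs_mult power2_eq_square)
  then show ?thesis
    using D unfolding compromise_t_def D_def[symmetric]
    by (simp only: abs_divide) (simp add: divide_simps)
qed

text \<open>Only the second argument enters the bound: with \<open>\<phi> n\<close> in that place,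
  \<open>\<bar>f * \<phi> n\<bar>\<close> dominates the right-hand side of the equation while the
  first argument varies.\<close>

lemma abs_compromise_le:
  assumes "0 < \<epsilon>" shows "\<bar>compromise \<epsilon> s t\<bar> \<le> \<bar>t\<bar>"
proof -
  define D where "D = s\<^sup>2 + t\<^sup>2 + \<epsilon>"
  have D: "0 < D" using denominator_pos[OF assms] by (simp add: D_def)
  have "(2 * \<bar>s * t\<bar>) * \<bar>t\<bar> \<le> D * \<bar>t\<bar>"
    using two_mult_le_denominator[OF assms, of s t] unfolding D_def by (intro mult_right_mono) auto
  then show ?thesis
    using D unfolding compromise_def D_def[symmetric]
    by (simp only: abs_divide) (simp add: divide_simps abs_mult power2_eq_square ac_simps)
qed

lemma has_derivative_compromise:
  assumes "0 < \<epsilon>" "(f has_derivative f') (at x)" "(g has_derivative g') (at x)"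
  shows "((\<lambda>x. compromise \<epsilon> (f x) (g x)) has_derivative
           (\<lambda>h. compromise_s \<epsilon> (f x) (g x) * f' h + compromise_t \<epsilon> (f x) (g x) * g' h)) (at x)"
proof -
  define D where "D = (f x)\<^sup>2 + (g x)\<^sup>2 + \<epsilon>"
  have D: "0 < D" using denominator_pos[OF assms(1)] by (simp add: D_def)
  show ?thesis
    unfolding compromise_def using D unfolding D_def
    apply (auto intro!: derivative_eq_intros assms(2,3) ext)
    apply (simp add: compromise_s_def compromise_t_def divide_simps)
    apply (simp add: algebra_simps power2_eq_square)
    done
qed

section \<open>Test functions and their gradients\<close>

lemma test_functions_D:
  assumes "\<phi> \<in> test_functions \<Omega>"
  shows "times_cont_differentiable k \<phi>" "\<phi> differentiable at x" "continuous_on S (grad \<phi>)" "continuous_on S \<phi>"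
proof -
  show *: "times_cont_differentiable k \<phi>" for k
    using assms by (simp add: test_functions_def)
  show "\<phi> differentiable at x" for x
    using *[of "Suc 0"] by simp
  then show "continuous_on S \<phi>"
    by (simp add: continuous_at_imp_continuous_on differentiable_imp_continuous_within)
  have "continuous_on UNIV (grad \<phi>)"
    unfolding grad_def using *[of "Suc 0"] by (intro continuous_intros) simp
  then show "continuous_on S (grad \<phi>)"
    using continuous_on_subset by blast
qed

lemma grad_eqI:
  assumes "(f has_derivative f') (at x)" shows "grad f x = (\<Sum>i\<in>Basis. f' i *\<^sub>R i)"
  using frechet_derivative_at[OF assms] by (simp add: grad_def)

lemma grad_compromise:
  assumes "0 < \<epsilon>" "\<phi> differentiable at x" "\<psi> differentiable at x"
  shows "grad (\<lambda>x. compromise \<epsilon> (\<phi> x) (\<psi> x)) x =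
           compromise_s \<epsilon> (\<phi> x) (\<psi> x) *\<^sub>R grad \<phi> x + compromise_t \<epsilon> (\<phi> x) (\<psi> x) *\<^sub>R grad \<psi> x"
  using grad_eqI[OF has_derivative_compromise[OF assms(1) assms(2,3)[unfolded frechet_derivative_works]]]
  by (simp add: grad_def algebra_simps sum.distrib scaleR_sum_right)

lemma test_functions_compromise:
  assumes "0 < \<epsilon>" "\<phi> \<in> test_functions \<Omega>" "\<psi> \<in> test_functions \<Omega>"
  shows "(\<lambda>x. compromise \<epsilon> (\<phi> x) (\<psi> x)) \<in> test_functions \<Omega>"
proof -
  have "{x. compromise \<epsilon> (\<phi> x) (\<psi> x) \<noteq> 0} \<subseteq> {x. \<psi> x \<noteq> 0}"
    by (auto simp: compromise_def)
  then have "closure {x. compromise \<epsilon> (\<phi> x) (\<psi> x) \<noteq> 0} \<subseteq> closure {x. \<psi> x \<noteq> 0}"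
      "bounded {x. \<psi> x \<noteq> 0} \<longrightarrow> bounded {x. compromise \<epsilon> (\<phi> x) (\<psi> x) \<noteq> 0}"
    using closure_mono bounded_subset by blast+
  moreover have "times_cont_differentiable k (\<lambda>x. compromise \<epsilon> (\<phi> x) (\<psi> x))" for k
  proof -
    have "times_cont_differentiable k (\<lambda>x. (2 * \<phi> x) * (\<psi> x * \<psi> x) *
            inverse ((\<phi> x * \<phi> x + \<psi> x * \<psi> x) + \<epsilon>))"
      using denominator_pos[OF assms(1), of "\<phi> _" "\<psi> _"]
      by (intro times_cont_differentiable_mult times_cont_differentiable_inverse
          times_cont_differentiable_add times_cont_differentiable_const test_functions_D(1)[OF assms(2)]
          test_functions_D(1)[OF assms(3)]) (metis less_irrefl power2_eq_square)
    then show ?thesis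
      by (simp add: compromise_def power2_eq_square divide_inverse)
  qed
  ultimately show ?thesis
    using assms(3) unfolding test_functions_def
    by auto
qed

lemma frechet_derivative_Basis_le_norm_grad:
  assumes "b \<in> Basis"
  shows "\<bar>frechet_derivative f (at x) b\<bar> \<le> norm (grad f x)"
proof -
  have "grad f x \<bullet> b = frechet_derivative f (at x) b"
    using assms by (simp add: grad_def inner_sum_left inner_Basis if_distrib cong: if_cong)
  then show ?thesis
    using Basis_le_norm[OF assms, of "grad f x"] by simp
qed

lemma grad_eq_0_outside:
  assumes "x \<notin> closure {x. \<phi> x \<noteq> 0}"
  shows "grad \<phi> x = 0"
proof -
  have "(\<phi> has_derivative (\<lambda>h. 0)) (at x)"
    by (rule has_derivative_transform_within_open[where f = "\<lambda>x. 0" and s = "- closure {x. \<phi> x \<noteq> 0}"])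
       (use assms closure_subset[of "{x. \<phi> x \<noteq> 0}"] in auto)
  then show ?thesis
    by (simp add: grad_eqI)
qed

section \<open>Dominated subsequences and integrals over the half space\<close>

text \<open>Along a subsequence with integrals below \<open>(1/2)^n\<close> the series of the
  \<open>F (r n)\<close> has an integrable sum. This sum dominates every term, and convergence
  almost everywhere forces the terms to \<open>0\<close>.\<close>

lemma L1_null_dominated_subseq:
  fixes F :: "nat \<Rightarrow> 'a \<Rightarrow> real"
  assumes int: "\<And>n. integrable M (F n)"
    and nonneg: "\<And>n x. 0 \<le> F n x"
    and lim: "(\<lambda>n. \<integral>x. F n x \<partial>M) \<longlonglongrightarrow> 0"
  obtains r g where "strict_mono r" "integrable M g"
    "AE x in M. (\<lambda>n. F (r n) x) \<longlonglongrightarrow> 0" "AE x in M. \<forall>n. F (r n) x \<le> g x"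
proof -
  have "\<exists>r. \<forall>n. (\<integral>x. F (r n) x \<partial>M) < (1/2)^n \<and> r n < r (Suc n)"
  proof (rule dependent_nat_choice)
    fix x n :: nat
    have "\<forall>\<^sub>F m in sequentially. (\<integral>x. F m x \<partial>M) < (1/2)^Suc n \<and> x < m"
      using order_tendstoD(2)[OF lim, of "(1/2)^Suc n"] eventually_gt_at_top by (auto elim: eventually_conj)
    then show "\<exists>m. (\<integral>x. F m x \<partial>M) < (1/2)^Suc n \<and> x < m"
      using eventually_happens'[OF sequentially_bot] by blast
  next
    show "\<exists>m. (\<integral>x. F m x \<partial>M) < (1/2)^0"
      using eventually_happens'[OF sequentially_bot order_tendstoD(2)[OF lim, of 1]] by auto
  qed
  then obtain r where r: "\<And>n. (\<integral>x. F (r n) x \<partial>M) < (1/2)^n" "\<And>n. r n < r (Suc n)"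
    by blast
  have summ: "summable (\<lambda>n. \<integral>x. F (r n) x \<partial>M)"
    by (rule summable_comparison_test'[of "\<lambda>n. (1/2)^n" 0])
       (use r(1) nonneg in \<open>auto simp: less_imp_le integral_nonneg\<close>)
  have [measurable]: "\<And>n. F n \<in> borel_measurable M"
    using int by auto
  have "(\<integral>\<^sup>+x. (\<Sum>n. ennreal (F (r n) x)) \<partial>M) = (\<Sum>n. ennreal (\<integral>x. F (r n) x \<partial>M))"
    using int nonneg by (subst nn_integral_suminf) (auto simp: nn_integral_eq_integral)
  also have "\<dots> = ennreal (\<Sum>n. \<integral>x. F (r n) x \<partial>M)"
    using nonneg by (intro suminf_ennreal2 summ) (auto simp: integral_nonneg)
  finally have "(\<integral>\<^sup>+x. (\<Sum>n. ennreal (F (r n) x)) \<partial>M) \<noteq> \<infinity>"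
    by simp
  then have "AE x in M. (\<Sum>n. ennreal (F (r n) x)) \<noteq> \<infinity>"
    by (intro nn_integral_PInf_AE) auto
  then have ae: "AE x in M. summable (\<lambda>n. F (r n) x)"
    by eventually_elim (use nonneg in \<open>auto intro: summable_suminf_not_top\<close>)
  show ?thesis
  proof
    show "strict_mono r"
      using r(2) by (simp add: strict_mono_Suc_iff)
    show "integrable M (\<lambda>x. \<Sum>n. F (r n) x)"
      using ae summ nonneg int by (intro integrable_suminf) auto
    show "AE x in M. (\<lambda>n. F (r n) x) \<longlonglongrightarrow> 0"
      using ae by eventually_elim (rule summable_LIMSEQ_zero)
    show "AE x in M. \<forall>n. F (r n) x \<le> (\<Sum>n. F (r n) x)"
      using ae
    proof eventually_elim
      case (elim x)
      then show ?case
        using sum_le_suminf[OF elim, of "{_}"] nonneg by simp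
    qed
  qed
qed

section \<open>Scalar inequalities for real powers\<close>

lemma norm_powr_add_le:
  fixes x y :: "'a::real_normed_vector"
  assumes "0 \<le> p"
  shows "norm (x + y) powr p \<le> 2 powr p * (norm x powr p + norm y powr p)"
proof -
  have "norm (x + y) \<le> 2 * max (norm x) (norm y)"
    using norm_triangle_ineq[of x y] by linarith
  then have "norm (x + y) powr p \<le> 2 powr p * max (norm x) (norm y) powr p"
    using powr_mono2[OF assms norm_ge_zero] by (metis powr_mult)
  also have "max (norm x) (norm y) powr p \<le> norm x powr p + norm y powr p"
    by (auto simp: max_def)
  finally show ?thesis
    by simp
qed

text \<open>Young's inequality for the conjugate pair \<open>p / (p - 1)\<close> and
  \<open>p\<close>, stated with the power \<open>p - 1\<close> that both the flux and the integrand
  in \<open>C_delta_hardy\<close> carry.\<close>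

lemma powr_Young:
  fixes X Y :: real
  assumes "1 < p" "0 \<le> X" "0 \<le> Y"
  shows "X powr (p - 1) * Y \<le> (1 - 1/p) * X powr p + 1/p * Y powr p"
proof -
  have "X powr (p - 1) * Y \<le> (X powr (p - 1)) powr (p / (p - 1)) / (p / (p - 1)) + Y powr p / p"
    using assms by (intro Youngs_inequality) (auto simp: field_simps)
  also have "(X powr (p - 1)) powr (p / (p - 1)) = X powr p"
    using assms by (simp add: powr_powr)
  finally show ?thesis
    using assms by (simp add: field_simps)
qed

section \<open>Integrals over the half space\<close>

lemma half_space_sets [measurable, simp]:
  shows "(half_space :: 'm::finite space_N set) \<in> sets borel"
    and "(half_space :: 'm::finite space_N set) \<in> sets lebesgue"
proof -
  have "open (half_space :: 'm space_N set)"
    unfolding half_space_def by (intro open_Collect_less continuous_intros)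
  then show "(half_space :: 'm space_N set) \<in> sets borel" by (rule borel_open)
  then show "(half_space :: 'm space_N set) \<in> sets lebesgue" by auto
qed

lemma space_half_measure [simp]: "space half_measure = half_space"
  by (simp add: space_restrict_space)

text \<open>\<open>half_measure\<close> restricts the completed measure, whereas translation
  invariance and integrability over compact sets are used for \<open>lborel\<close>. For Borel
  integrands the completion changes nothing.\<close>

lemma integral_half_measure_borel:
  fixes f :: "'m::finite space_N \<Rightarrow> real"
  assumes "(\<lambda>x. indicator half_space x * f x) \<in> borel_measurable borel"
  shows "integrable half_measure f \<longleftrightarrow> integrable lborel (\<lambda>x. indicator half_space x * f x)"
    and "integral\<^sup>L half_measure f = integral\<^sup>L lborel (\<lambda>x. indicator half_space x * f x)"
  using assms by (simp_all add: integrable_restrict_space integral_restrict_space integrable_completion integral_completion)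

text \<open>Test functions need not vanish on the boundary, so \<open>K\<close> may touch it.
  Continuity up to the boundary makes \<open>f\<close> integrable over the compact set
  \<open>?S\<close>, and the indicator of the open half space then removes the hyperplane.\<close>

lemma half_space_compact_support:
  fixes f :: "'m::finite space_N \<Rightarrow> real"
  assumes "compact K" "continuous_on {x. 0 \<le> snd x} f" "\<And>x. x \<in> half_space \<Longrightarrow> x \<notin> K \<Longrightarrow> f x = 0"
  shows "integrable lborel (\<lambda>x. indicator half_space x * f x)" "integrable half_measure f"
proof -
  let ?S = "K \<inter> {x. 0 \<le> snd x}"
  have "closed {x::'m space_N. 0 \<le> snd x}"
    by (intro closed_Collect_le continuous_intros)
  then have "integrable lborel (\<lambda>x. indicator ?S x *\<^sub>R f x)"
    using assms by (intro borel_integrable_compact) (auto intro: continuous_on_subset)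
  then have "integrable lborel (\<lambda>x. indicator half_space x *\<^sub>R (indicator ?S x *\<^sub>R f x))"
    by (rule integrable_mult_indicator[rotated]) simp
  also have "(\<lambda>x. indicator half_space x *\<^sub>R (indicator ?S x *\<^sub>R f x)) = (\<lambda>x. indicator half_space x * f x)"
    using assms(3) by (auto simp: fun_eq_iff indicator_def half_space_def)
  finally show *: "integrable lborel (\<lambda>x. indicator half_space x * f x)" .
  then show "integrable half_measure f"
    by (subst integral_half_measure_borel) auto
qed

text \<open>Integrating \<open>F (x + h e\<^sub>N) - F x\<close> with \<open>h > 0\<close> loses the mass of \<open>F\<close> in the strip \<open>0 < x\<^sub>N \<le> h\<close>, so the
  difference quotients have nonpositive integrals; this replaces Fubini and integration by parts.\<close>

lemma integral_vertical_derivative_le_0: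
  fixes F F' :: "'m::finite space_N \<Rightarrow> real"
  assumes K: "compact K"
    and F: "continuous_on {x. 0 \<le> snd x} F" "\<And>x. 0 \<le> F x"
      "\<And>x. x \<notin> K \<Longrightarrow> F x = 0"
    and F': "continuous_on {x. 0 \<le> snd x} F'" "\<And>x. x \<notin> K \<Longrightarrow> F' x = 0"
    and deriv: "\<And>x y. 0 < y \<Longrightarrow> ((\<lambda>y. F (x, y)) has_real_derivative F' (x, y)) (at y)"
  shows "(\<integral>x. F' x \<partial>half_measure) \<le> 0"
proof -
  define h where "h n = inverse (real (Suc n))" for n
  have h: "0 < h n" "h n \<le> 1" for n
    by (auto simp: h_def inverse_le_1_iff)
  have h0: "h \<longlonglongrightarrow> 0"
    unfolding h_def by (rule LIMSEQ_inverse_real_of_nat)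
  define e :: "'m space_N" where "e = (0, 1)"
  have ne: "norm e = 1" by (simp add: e_def norm_Pair)
  define D where "D n x = (F (x + h n *\<^sub>R e) - F x) / h n" for n x
  \<comment> \<open>Extension by zero outside the half space, so that translation invariance on the
    whole space applies.\<close>
  define Fh where "Fh x = indicator half_space x * F x" for x
  have Fh: "integrable lborel Fh" and intF: "integrable half_measure F"
    using half_space_compact_support[OF K F(1)] F(3) by (auto simp: Fh_def[abs_def])
  have [measurable]: "Fh \<in> borel_measurable borel"
    using borel_measurable_integrable[OF Fh] by simp
  have intF': "integrable half_measure F'"
    using half_space_compact_support[OF K F'(1)] F'(2) by auto
  have shift: "x + h n *\<^sub>R e \<in> half_space" if "x \<in> half_space" for x n
    using that h[of n] by (simp add: half_space_def e_def)
  have eqsh: "(\<lambda>x. indicator half_space x * F (x + h n *\<^sub>R e)) =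
     (\<lambda>x. indicator half_space x * Fh (x + h n *\<^sub>R e))" for n
    using shift by (auto simp: Fh_def indicator_def fun_eq_iff)
  have meas: "(\<lambda>x. indicator half_space x * F (x + h n *\<^sub>R e)) \<in> borel_measurable borel" for n
    unfolding eqsh by measurable
  have Fh_shift: "integrable lborel (\<lambda>x. Fh (x + h n *\<^sub>R e))"
      "integral\<^sup>L lborel (\<lambda>x. Fh (x + h n *\<^sub>R e)) = integral\<^sup>L lborel Fh" for n
  proof -
    have "integrable (distr lborel borel ((+) (h n *\<^sub>R e))) Fh"
      using Fh by (simp add: lborel_distr_plus)
    then show "integrable lborel (\<lambda>x. Fh (x + h n *\<^sub>R e))"
      by (subst (asm) integrable_distr_eq) (auto simp: add.commute)
    have "integral\<^sup>L lborel Fh = integral\<^sup>L (distr lborel borel ((+) (h n *\<^sub>R e))) Fh"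
      by (simp add: lborel_distr_plus)
    also have "\<dots> = integral\<^sup>L lborel (\<lambda>x. Fh (x + h n *\<^sub>R e))"
      by (subst integral_distr) (auto simp: add.commute)
    finally show "integral\<^sup>L lborel (\<lambda>x. Fh (x + h n *\<^sub>R e)) = integral\<^sup>L lborel Fh" ..
  qed
  have int_ish: "integrable lborel (\<lambda>x. indicator half_space x * F (x + h n *\<^sub>R e))" for n
    unfolding eqsh using integrable_mult_indicator[OF _ Fh_shift(1), of half_space n] by simp
  then have int_sh: "integrable half_measure (\<lambda>x. F (x + h n *\<^sub>R e))" for n
    by (subst integral_half_measure_borel[OF meas])
  have "(\<integral>x. F (x + h n *\<^sub>R e) \<partial>half_measure) \<le> (\<integral>x. F x \<partial>half_measure)" for n
  proof -
    have "(\<integral>x. F (x + h n *\<^sub>R e) \<partial>half_measure)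
        = integral\<^sup>L lborel (\<lambda>x. indicator half_space x * F (x + h n *\<^sub>R e))"
      by (rule integral_half_measure_borel[OF meas])
    also have "\<dots> \<le> integral\<^sup>L lborel (\<lambda>x. Fh (x + h n *\<^sub>R e))"
      using shift F(2) by (intro integral_mono int_ish Fh_shift) (auto simp: Fh_def indicator_def)
    also have "\<dots> = (\<integral>x. F x \<partial>half_measure)"
      unfolding Fh_shift by (subst integral_half_measure_borel) (auto simp: Fh_def[abs_def, symmetric])
    finally show ?thesis .
  qed
  then have Dle: "(\<integral>x. D n x \<partial>half_measure) \<le> 0" for n
    using h[of n] int_sh[of n] intF by (simp add: D_def divide_nonpos_pos)
  have "closed {x::'m space_N. 0 \<le> snd x}"
    by (intro closed_Collect_le continuous_intros)
  then have "compact (K \<inter> {x. 0 \<le> snd x})"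
    using K by auto
  then have "bounded (F' ` (K \<inter> {x. 0 \<le> snd x}))"
    by (intro compact_imp_bounded compact_continuous_image continuous_on_subset[OF F'(1)]) auto
  then obtain B where B: "0 < B" "\<And>x. x \<in> K \<Longrightarrow> 0 \<le> snd x \<Longrightarrow> \<bar>F' x\<bar> \<le> B"
    by (auto simp: bounded_pos)
  have B': "\<bar>F' x\<bar> \<le> B" if "0 \<le> snd x" for x
    using B(1) B(2)[of x] F'(2)[of x] that by (cases "x \<in> K") auto
  from K obtain R where R: "\<And>x. x \<in> K \<Longrightarrow> norm x \<le> R"
    using compact_imp_bounded bounded_iff by metis
  \<comment> \<open>Steps are at most \<open>1\<close>, so outside the ball of radius
    \<open>R + 1\<close> both \<open>x\<close> and its shift miss \<open>K\<close> and the quotient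
    is \<open>0\<close>; inside, the mean value theorem bounds it by \<open>B\<close>.\<close>
  let ?C = "cball (0 :: 'm space_N) (R + 1)"
  have bound: "norm (D n x) \<le> B * indicator ?C x" if x: "x \<in> half_space" for n x
  proof (cases "x \<in> ?C")
    case True
    obtain a b where ab: "x = (a, b)" by (cases x)
    have b: "0 < b" using x ab by (simp add: half_space_def)
    have "\<exists>z>b. z < b + h n \<and> F (a, b + h n) - F (a, b) = (b + h n - b) * F' (a, z)"
      using b h[of n] by (intro MVT2 deriv) auto
    then obtain z where z: "z > b" "F (a, b + h n) - F (a, b) = h n * F' (a, z)"
      by auto
    then have "D n x = F' (a, z)"
      using h[of n] by (simp add: D_def ab e_def)
    then show ?thesis
      using B'[of "(a, z)"] z b True by simp
  next
    case False
    then have "x \<notin> K" using R[of x] by auto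
    moreover have "x + h n *\<^sub>R e \<notin> K"
    proof
      assume "x + h n *\<^sub>R e \<in> K"
      then have "norm (x + h n *\<^sub>R e) \<le> R" by (rule R)
      moreover have "norm (h n *\<^sub>R e) \<le> 1" using h[of n] ne by simp
      ultimately have "norm x \<le> R + 1"
        using norm_triangle_ineq4[of "x + h n *\<^sub>R e" "h n *\<^sub>R e"] by simp
      then show False using False by simp
    qed
    ultimately show ?thesis
      using F(3) B(1) by (simp add: D_def)
  qed
  have conv: "(\<lambda>n. D n x) \<longlonglongrightarrow> F' x" if x: "x \<in> half_space" for x
  proof -
    obtain a b where ab: "x = (a, b)" by (cases x)
    have b: "0 < b" using x ab by (simp add: half_space_def)
    have "((\<lambda>t. (F (a, b + t) - F (a, b)) / t) \<longlongrightarrow> F' (a, b)) (at 0)"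
      using deriv[OF b] by (simp add: DERIV_def)
    moreover have "filterlim h (at 0) sequentially"
      using h0 h(1) by (auto simp: filterlim_at intro!: always_eventually) (metis less_irrefl)
    ultimately have "(\<lambda>n. (F (a, b + h n) - F (a, b)) / h n) \<longlonglongrightarrow> F' (a, b)"
      by (rule filterlim_compose)
    then show ?thesis by (simp add: D_def ab e_def)
  qed
  have "(\<lambda>n. \<integral>x. D n x \<partial>half_measure) \<longlonglongrightarrow> (\<integral>x. F' x \<partial>half_measure)"
  proof (rule integral_dominated_convergence)
    show "F' \<in> borel_measurable half_measure" using intF' by auto
    show "D n \<in> borel_measurable half_measure" for n
      unfolding D_def[abs_def] using int_sh[of n] intF by (intro borel_measurable_divide borel_measurable_diff) auto
    have "integrable lborel (\<lambda>x. indicator half_space x * (B * indicator ?C x))"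
    proof -
      have "integrable lborel (\<lambda>x. indicator ?C x *\<^sub>R B)"
        by (rule borel_integrable_compact) auto
      then have "integrable lborel (\<lambda>x. indicator half_space x *\<^sub>R (indicator ?C x *\<^sub>R B))"
        by (rule integrable_mult_indicator[rotated]) simp
      then show ?thesis by (simp add: mult.commute)
    qed
    then show "integrable half_measure (\<lambda>x. B * indicator ?C x)"
      by (subst integral_half_measure_borel) auto
    show "AE x in half_measure. (\<lambda>n. D n x) \<longlonglongrightarrow> F' x"
      using conv by (intro AE_I2) simp
    show "AE x in half_measure. norm (D n x) \<le> B * indicator ?C x" for n
      using bound by (intro AE_I2) simp
  qed
  then show ?thesis
    by (rule LIMSEQ_le_const2) (use Dle in auto)
qed

section \<open>The power of an absolute value and its derivative\<close>

text \<open>For \<open>p < 2\<close> the first factor blows up at \<open>0\<close>. Written through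
  the positive and negative parts of \<open>t\<close>, the product contains only the power
  \<open>p - 1 > 0\<close>.\<close>

lemma continuous_on_abs_powr_mult:
  fixes p :: real
  assumes "1 < p"
  shows "continuous_on UNIV (\<lambda>t::real. \<bar>t\<bar> powr (p - 2) * t)"
proof -
  have "\<bar>t\<bar> powr (p - 2) * t = max t 0 powr (p - 1) - max (- t) 0 powr (p - 1)" for t :: real
  proof -
    consider "t = 0" | "t > 0" | "t < 0" by linarith
    then show ?thesis
      using powr_add[of "\<bar>t\<bar>" "p - 2" 1] by cases auto
  qed
  moreover have "continuous_on UNIV (\<lambda>t::real. max t 0 powr (p - 1) - max (- t) 0 powr (p - 1))"
    using assms by (intro continuous_intros continuous_on_powr') auto
  ultimately show ?thesis by simp
qed

text \<open>At \<open>t = 0\<close> the difference quotient has modulus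
  \<open>\<bar>h\<bar> powr (p - 1)\<close>, which tends to \<open>0\<close> because
  \<open>1 < p\<close>; on either side of \<open>0\<close> the usual power rule applies.\<close>

lemma DERIV_abs_powr:
  fixes p t :: real
  assumes "1 < p"
  shows "((\<lambda>t. \<bar>t\<bar> powr p) has_real_derivative p * (\<bar>t\<bar> powr (p - 2) * t)) (at t)"
proof -
  consider "t = 0" | "t > 0" | "t < 0" by linarith
  then show ?thesis
  proof cases
    case 1
    have "((\<lambda>h::real. \<bar>h\<bar> powr (p - 1)) \<longlongrightarrow> 0 powr (p - 1)) (at 0)"
      using assms by (intro tendsto_powr' tendsto_eq_intros) (auto intro: always_eventually)
    then have "((\<lambda>h::real. \<bar>h\<bar> powr (p - 1)) \<longlongrightarrow> 0) (at 0)" by simp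
    then have "((\<lambda>h::real. \<bar>h\<bar> powr p / h) \<longlongrightarrow> 0) (at 0)"
    proof (rule Lim_null_comparison[rotated])
      have "norm (\<bar>h\<bar> powr p / h) = \<bar>h\<bar> powr (p - 1)" if "h \<noteq> 0" for h :: real
        using that by (simp add: powr_diff)
      then show "\<forall>\<^sub>F h::real in at 0. norm (\<bar>h\<bar> powr p / h) \<le> \<bar>h\<bar> powr (p - 1)"
        by (auto simp: eventually_at_filter)
    qed
    then show ?thesis using 1 by (simp add: DERIV_def)
  next
    case 2
    have "((\<lambda>t. t powr p) has_real_derivative p * (\<bar>t\<bar> powr (p - 2) * t)) (at t)"
      using 2 powr_add[of "t" "p - 2" 1] by (auto intro!: derivative_eq_intros)
    then show ?thesis
      using 2 by (rule_tac has_field_derivative_transform_within_open[where S = "{0<..}"]) auto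
  next
    case 3
    have "((\<lambda>t. (- t) powr p) has_real_derivative p * (\<bar>t\<bar> powr (p - 2) * t)) (at t)"
      using 3 powr_add[of "- t" "p - 2" 1] by (auto intro!: derivative_eq_intros)
    then show ?thesis
      using 3 by (rule_tac has_field_derivative_transform_within_open[where S = "{..<0}"]) auto
  qed
qed

lemma C_delta_powr_integrable:
  fixes \<phi> :: "'m::finite space_N \<Rightarrow> real"
  assumes \<phi>: "\<phi> \<in> C_delta" and p: "1 < p"
  shows "integrable half_measure (\<lambda>x. (1 + snd x) powr \<alpha> * \<bar>\<phi> x\<bar> powr p)"
    and "integrable half_measure (\<lambda>x. (1 + snd x) powr \<alpha> * \<bar>\<phi> x\<bar> powr (p - 1) * norm (grad \<phi> x))"
proof -
  have K: "compact (closure {x. \<phi> x \<noteq> 0})"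
    using \<phi> by (simp add: test_functions_def)
  have out: "\<phi> x = 0" if "x \<notin> closure {x. \<phi> x \<noteq> 0}" for x
    using that closure_subset by force
  show "integrable half_measure (\<lambda>x. (1 + snd x) powr \<alpha> * \<bar>\<phi> x\<bar> powr p)"
    using p by (intro half_space_compact_support(2)[OF K] continuous_intros continuous_on_powr'
        test_functions_D(4)[OF \<phi>]) (auto dest!: out)
  show "integrable half_measure (\<lambda>x. (1 + snd x) powr \<alpha> * \<bar>\<phi> x\<bar> powr (p - 1) * norm (grad \<phi> x))"
    using p by (intro half_space_compact_support(2)[OF K] continuous_intros continuous_on_powr'
        test_functions_D(3,4)[OF \<phi>]) (auto dest!: out)
qed

section \<open>Hardy's inequality and passage to the limit in the test functions\<close>

text \<open>Hardy's inequality before Hoelder: in this form the integrand on the right vanishes where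
  \<open>\<phi> = 0\<close>, which survives the passage to the limit in \<open>E\<close>.\<close>

lemma C_delta_hardy:
  fixes \<phi> :: "'m::finite space_N \<Rightarrow> real"
  assumes \<phi>: "\<phi> \<in> C_delta" and p: "1 < p" and \<gamma>: "p - 1 < \<gamma>"
  shows "(\<gamma> - p + 1) * (\<integral>x. (1 + snd x) powr (\<gamma> - p) * \<bar>\<phi> x\<bar> powr p \<partial>half_measure) \<le>
     p * (\<integral>x. (1 + snd x) powr (\<gamma> - p + 1) * \<bar>\<phi> x\<bar> powr (p - 1) * norm (grad \<phi> x) \<partial>half_measure)"
proof -
  define c where "c = \<gamma> - p + 1"
  have c: "0 < c" using \<gamma> by (simp add: c_def)
  let ?K = "closure {x. \<phi> x \<noteq> 0}"
  have K: "compact ?K"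
    using \<phi> by (simp add: test_functions_def)
  have out: "\<phi> x = 0" if "x \<notin> ?K" for x
    using that closure_subset by force
  define d where "d x = frechet_derivative \<phi> (at x) (0, 1)" for x
  have e: "(0, 1) \<in> (Basis :: 'm space_N set)"
    by (simp add: Basis_prod_def)
  have d_le: "\<bar>d x\<bar> \<le> norm (grad \<phi> x)" for x
    unfolding d_def by (rule frechet_derivative_Basis_le_norm_grad[OF e])
  have d_cont: "continuous_on S d" for S
  proof -
    have "continuous_on UNIV d"
      using test_functions_D(1)[OF \<phi>, of "Suc 0"] e by (simp add: d_def[abs_def])
    then show ?thesis using continuous_on_subset by blast
  qed
  \<comment> \<open>\<open>F\<close> is chosen so that its vertical derivative is
    \<open>c * ?W + V\<close>: differentiating the weight gives the Hardy integrand
    \<open>?W\<close>, and differentiating \<open>\<bar>\<phi>\<bar> powr p\<close> gives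
    \<open>V\<close>, whose modulus is at most \<open>p * ?U\<close>.\<close>
  define F where "F x = (1 + snd x) powr c * \<bar>\<phi> x\<bar> powr p" for x
  define V where "V x = (1 + snd x) powr c * (p * (\<bar>\<phi> x\<bar> powr (p - 2) * \<phi> x) * d x)" for x
  let ?W = "\<lambda>x. (1 + snd x) powr (\<gamma> - p) * \<bar>\<phi> x\<bar> powr p"
  let ?U = "\<lambda>x. (1 + snd x) powr c * \<bar>\<phi> x\<bar> powr (p - 1) * norm (grad \<phi> x)"
  have powcont: "continuous_on S (\<lambda>x. \<bar>\<phi> x\<bar> powr (p - 2) * \<phi> x)" for S
    by (rule continuous_on_compose2[OF continuous_on_abs_powr_mult[OF p] test_functions_D(4)[OF \<phi>]]) auto
  have Wc: "continuous_on {x. 0 \<le> snd x} ?W" and Fc: "continuous_on {x. 0 \<le> snd x} F"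
    unfolding F_def using p by (auto intro!: continuous_intros continuous_on_powr' test_functions_D(4)[OF \<phi>])
  have Vc: "continuous_on {x. 0 \<le> snd x} V"
    unfolding V_def by (intro continuous_intros continuous_on_powr' powcont d_cont) auto
  have intV: "integrable half_measure V"
    by (rule half_space_compact_support(2)[OF K Vc]) (auto simp: V_def dest!: out)
  have intW: "integrable half_measure ?W" and intU: "integrable half_measure ?U"
    by (fact C_delta_powr_integrable[OF \<phi> p])+
  have deriv: "((\<lambda>y. F (x, y)) has_real_derivative c * ?W (x, y) + V (x, y)) (at y)" if "0 < y" for x y
  proof -
    have "(\<phi> has_derivative frechet_derivative \<phi> (at (x, y))) (at (x, y))"
      using test_functions_D(2)[OF \<phi>] by (simp add: frechet_derivative_works[symmetric])
    moreover have "((\<lambda>y. (x, y)) has_derivative (\<lambda>h. (0, h))) (at y)"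
      by (auto intro!: derivative_eq_intros)
    ultimately have "((\<lambda>y. \<phi> (x, y)) has_derivative (\<lambda>h. frechet_derivative \<phi> (at (x, y)) (0, h))) (at y)"
      using has_derivative_compose[of "\<lambda>y. (x, y)" "\<lambda>h. (0, h)" y UNIV \<phi>] by simp
    moreover have "frechet_derivative \<phi> (at (x, y)) (0, h) = d (x, y) * h" for h
      using linear_cmul[OF linear_frechet_derivative[OF test_functions_D(2)[OF \<phi>]], of "(x,y)" h "(0,1)"]
      by (simp add: d_def mult.commute)
    ultimately have "((\<lambda>y. \<phi> (x, y)) has_real_derivative d (x, y)) (at y)"
      by (simp add: has_field_derivative_def)
    then have "((\<lambda>y. \<bar>\<phi> (x, y)\<bar> powr p) has_real_derivative
        p * (\<bar>\<phi> (x, y)\<bar> powr (p - 2) * \<phi> (x, y)) * d (x, y)) (at y)"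
      by (rule DERIV_chain2[OF DERIV_abs_powr[OF p]])
    moreover have "((\<lambda>y. (1 + y) powr c) has_real_derivative c * (1 + y) powr (c - 1)) (at y)"
      using that by (auto intro!: derivative_eq_intros)
    ultimately have "((\<lambda>y. (1 + y) powr c * \<bar>\<phi> (x, y)\<bar> powr p) has_real_derivative
        c * (1 + y) powr (c - 1) * \<bar>\<phi> (x, y)\<bar> powr p +
        (p * (\<bar>\<phi> (x, y)\<bar> powr (p - 2) * \<phi> (x, y)) * d (x, y)) * (1 + y) powr c) (at y)"
      by (rule DERIV_mult[rotated])
    then show ?thesis
      by (simp add: F_def V_def c_def algebra_simps)
  qed
  have "(\<integral>x. c * ?W x + V x \<partial>half_measure) \<le> 0"
  proof (rule integral_vertical_derivative_le_0[OF K Fc])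
    show "continuous_on {x. 0 \<le> snd x} (\<lambda>x. c * ?W x + V x)"
      by (rule continuous_on_add[OF continuous_on_mult_left[OF Wc] Vc])
    show "0 \<le> F x" for x
      by (simp add: F_def)
    show "F x = 0" "c * ?W x + V x = 0" if "x \<notin> ?K" for x
      using out[OF that] p by (simp_all add: F_def V_def)
  qed (rule deriv)
  moreover have "(\<integral>x. c * ?W x + V x \<partial>half_measure) =
      c * (\<integral>x. ?W x \<partial>half_measure) + (\<integral>x. V x \<partial>half_measure)"
    using intW intV by simp
  moreover have "- (\<integral>x. V x \<partial>half_measure) \<le> p * (\<integral>x. ?U x \<partial>half_measure)"
  proof -
    have "\<bar>V x\<bar> \<le> p * ?U x" for x
    proof -
      have "\<bar>\<phi> x\<bar> powr (p - 2) * \<bar>\<phi> x\<bar> = \<bar>\<phi> x\<bar> powr (p - 1)"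
        using powr_add[of "\<bar>\<phi> x\<bar>" "p - 2" 1] by simp
      then have "\<bar>V x\<bar> = (p * (1 + snd x) powr c * \<bar>\<phi> x\<bar> powr (p - 1)) * \<bar>d x\<bar>"
        using p by (simp add: V_def abs_mult)
      also have "\<dots> \<le> (p * (1 + snd x) powr c * \<bar>\<phi> x\<bar> powr (p - 1)) * norm (grad \<phi> x)"
        using p d_le by (intro mult_left_mono) auto
      finally show ?thesis by (simp add: mult.assoc)
    qed
    then have "- V x \<le> p * ?U x" for x
      by (meson abs_le_D2)
    then have "(\<integral>x. - V x \<partial>half_measure) \<le> (\<integral>x. p * ?U x \<partial>half_measure)"
      using intV intU by (intro integral_mono) auto
    then show ?thesis by simp
  qed
  ultimately show ?thesis
    by (simp add: c_def)
qed

section \<open>Passage to the limit in the test functions\<close>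

text \<open>After Cauchy-Schwarz, Young's inequality bounds each weighted product of
  \<open>norm G powr (p - 1)\<close> with \<open>norm V\<close> or \<open>norm W\<close> by
  \<open>2 * \<Psi>\<close>; two such terms with coefficients at most \<open>2\<close> make
  \<open>8 * \<Psi>\<close>. This dominates the gradient side of the tested equation.\<close>

lemma duality_bound:
  fixes G V W :: "'e::real_inner"
  assumes p: "1 < p" and r: "0 \<le> r" and "r * norm G powr p \<le> \<Psi>" "r * norm V powr p \<le> \<Psi>" "r * norm W powr p \<le> \<Psi>"
    and "\<bar>\<sigma>\<bar> \<le> 2" "\<bar>\<tau>\<bar> \<le> 2"
  shows "\<bar>r * norm G powr (p - 2) * (G \<bullet> (\<sigma> *\<^sub>R V + \<tau> *\<^sub>R W))\<bar> \<le> 8 * \<Psi>"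
proof -
  have Y: "r * norm G powr (p - 1) * norm Z \<le> 2 * \<Psi>" if "r * norm Z powr p \<le> \<Psi>" for Z :: 'e
  proof -
    have "(1 - 1/p) * norm G powr p \<le> 1 * norm G powr p" "1/p * norm Z powr p \<le> 1 * norm Z powr p"
      using p mult_right_mono[of "1 - 1/p" 1 "norm G powr p"] mult_right_mono[of "1/p" 1 "norm Z powr p"]
      by auto
    then have "norm G powr (p - 1) * norm Z \<le> norm G powr p + norm Z powr p"
      using powr_Young[OF p, of "norm G" "norm Z"] by simp
    then have "r * (norm G powr (p - 1) * norm Z) \<le> r * (norm G powr p + norm Z powr p)"
      using r by (rule mult_left_mono)
    then show ?thesis
      using assms that by (simp add: algebra_simps)
  qed
  have "norm (\<sigma> *\<^sub>R V + \<tau> *\<^sub>R W) \<le> \<bar>\<sigma>\<bar> * norm V + \<bar>\<tau>\<bar> * norm W"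
    using norm_triangle_ineq[of "\<sigma> *\<^sub>R V" "\<tau> *\<^sub>R W"] by simp
  also have "\<dots> \<le> 2 * norm V + 2 * norm W"
    using assms by (intro add_mono mult_right_mono) auto
  finally have "norm G * norm (\<sigma> *\<^sub>R V + \<tau> *\<^sub>R W) \<le> norm G * (2 * norm V + 2 * norm W)"
    by (intro mult_left_mono) auto
  then have "\<bar>G \<bullet> (\<sigma> *\<^sub>R V + \<tau> *\<^sub>R W)\<bar> \<le> norm G * (2 * norm V + 2 * norm W)"
    using Cauchy_Schwarz_ineq2 order_trans by blast
  then have "\<bar>r * norm G powr (p - 2) * (G \<bullet> (\<sigma> *\<^sub>R V + \<tau> *\<^sub>R W))\<bar> \<le>
      r * norm G powr (p - 2) * (norm G * (2 * norm V + 2 * norm W))"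
    using r by (simp add: abs_mult mult_left_mono)
  also have "\<dots> = r * (norm G powr (p - 2) * norm G) * (2 * norm V + 2 * norm W)"
    by (simp only: mult.assoc)
  also have "norm G powr (p - 2) * norm G = norm G powr (p - 1)"
    using powr_add[of "norm G" "p - 2" 1] by simp
  also have "r * norm G powr (p - 1) * (2 * norm V + 2 * norm W) =
     2 * (r * norm G powr (p - 1) * norm V) + 2 * (r * norm G powr (p - 1) * norm W)"
    by (simp add: algebra_simps)
  finally show ?thesis
    using Y[OF assms(4)] Y[OF assms(5)] by linarith
qed

lemma norm_powr_mult_inner_self:
  fixes G :: "'e::real_inner"
  shows "norm G powr (p - 2) * (G \<bullet> G) = norm G powr p"
  using powr_add[of "norm G" "p - 2" 2] by (simp add: power2_norm_eq_inner)

lemma compromise_diagonal: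
  assumes "0 < \<epsilon>"
  shows "\<bar>compromise_s \<epsilon> s s + compromise_t \<epsilon> s s\<bar> \<le> 4"
  using abs_compromise_s_le[OF assms, of s s] abs_compromise_t_le[OF assms, of s s] by linarith

text \<open>For \<open>\<epsilon> > 0\<close> the sum is the derivative of
  \<open>s \<mapsto> compromise \<epsilon> s s\<close>. It vanishes at \<open>s = 0\<close> whatever
  \<open>\<epsilon>\<close> is, which is why the last limit retains only the set where
  \<open>u\<close> is nonzero.\<close>

lemma compromise_diagonal_tendsto:
  assumes "e \<longlonglongrightarrow> 0"
  shows "(\<lambda>k. compromise_s (e k) s s + compromise_t (e k) s s) \<longlonglongrightarrow> (if s = 0 then 0 else 1)"
proof (cases "s = 0")
  case False
  then have nz: "(s\<^sup>2 + s\<^sup>2 + 0)\<^sup>2 \<noteq> 0" by simp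
  have "(\<lambda>k. compromise_s (e k) s s + compromise_t (e k) s s) \<longlonglongrightarrow> compromise_s 0 s s + compromise_t 0 s s"
    unfolding compromise_s_def compromise_t_def by (intro tendsto_intros assms nz)
  moreover have "compromise_s 0 s s + compromise_t 0 s s = 1"
    using False by (simp add: compromise_s_def compromise_t_def power2_eq_square field_simps)
  ultimately show ?thesis using False by simp
qed (simp add: compromise_s_def compromise_t_def)

lemma tendsto_compromise:
  assumes "0 < \<epsilon>" "(f \<longlongrightarrow> s) L" "(g \<longlongrightarrow> t) L"
  shows "((\<lambda>x. compromise \<epsilon> (f x) (g x)) \<longlongrightarrow> compromise \<epsilon> s t) L"
    and "((\<lambda>x. compromise_s \<epsilon> (f x) (g x)) \<longlongrightarrow> compromise_s \<epsilon> s t) L"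
    and "((\<lambda>x. compromise_t \<epsilon> (f x) (g x)) \<longlongrightarrow> compromise_t \<epsilon> s t) L"
  unfolding compromise_def compromise_s_def compromise_t_def
  using denominator_pos[OF assms(1), of s t] by (auto intro!: tendsto_intros assms(2,3))

lemma borel_measurable_compromise [measurable]:
  assumes [measurable]: "f \<in> borel_measurable M" "g \<in> borel_measurable M"
  shows "(\<lambda>x. compromise \<epsilon> (f x) (g x)) \<in> borel_measurable M"
    and "(\<lambda>x. compromise_s \<epsilon> (f x) (g x)) \<in> borel_measurable M"
    and "(\<lambda>x. compromise_t \<epsilon> (f x) (g x)) \<in> borel_measurable M"
  unfolding compromise_def compromise_s_def compromise_t_def by measurable

lemma compromise_eq_quotient: "compromise \<epsilon> s t = s * (2 * t\<^sup>2 / (s\<^sup>2 + t\<^sup>2 + \<epsilon>))"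
  by (simp add: compromise_def)

text \<open>Nonnegativity keeps the sign of \<open>s\<close> in \<open>compromise\<close>, the bound
  \<open>2\<close> serves for domination, and the sharper bound \<open>1\<close> on the diagonal
  keeps the constant \<open>\<kappa>\<close> in \<open>testing_limit\<close> intact.\<close>

lemma quotient_bounds:
  assumes "0 < (\<epsilon>::real)"
  shows "0 \<le> 2 * t\<^sup>2 / (s\<^sup>2 + t\<^sup>2 + \<epsilon>)" "2 * t\<^sup>2 / (s\<^sup>2 + t\<^sup>2 + \<epsilon>) \<le> 2" "2 * s\<^sup>2 / (s\<^sup>2 + s\<^sup>2 + \<epsilon>) \<le> 1"
  using assms denominator_pos[OF assms, of s t] denominator_pos[OF assms, of s s] by (auto simp: divide_simps)

text \<open>Here \<open>g n\<close> and \<open>G\<close> stand for gradients, \<open>f\<close> for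
  the right-hand side of the equation and \<open>v\<close> for the Hardy density. The limits are
  taken in the order \<open>m\<close>, \<open>n\<close>, \<open>\<epsilon>\<close>. After the first
  one \<open>f * compromise\<close> is \<open>f * u\<close> times a nonnegative factor, so
  \<open>sign\<close> replaces it by the integrable \<open>v\<close> before the second
  limit.\<close>

lemma testing_limit:
  fixes \<phi> :: "nat \<Rightarrow> 'a \<Rightarrow> real" and g :: "nat \<Rightarrow> 'a \<Rightarrow> 'e::euclidean_space" and u :: "'a \<Rightarrow> real"
  assumes [measurable]: "\<rho> \<in> borel_measurable M" "u \<in> borel_measurable M" "G \<in> borel_measurable M"
      "\<And>n. \<phi> n \<in> borel_measurable M" "\<And>n. g n \<in> borel_measurable M"
    and p: "1 < p" and \<kappa>: "0 \<le> \<kappa>"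
    and \<rho>: "AE x in M. 0 \<le> \<rho> x"
    and v: "integrable M v" "AE x in M. 0 \<le> v x"
    and \<Psi>: "integrable M \<Psi>" "AE x in M. \<forall>n. \<rho> x * norm (g n x) powr p \<le> \<Psi> x"
      "AE x in M. \<rho> x * norm (G x) powr p \<le> \<Psi> x"
    and \<phi>: "AE x in M. (\<lambda>n. \<phi> n x) \<longlonglongrightarrow> u x"
    and g: "AE x in M. (\<lambda>n. g n x) \<longlonglongrightarrow> G x"
    and f: "\<And>n. integrable M (\<lambda>x. f x * \<phi> n x)"
    and f_test: "\<And>\<epsilon> m n. 0 < \<epsilon> \<Longrightarrow> integrable M (\<lambda>x. f x * compromise \<epsilon> (\<phi> m x) (\<phi> n x))"
    and test: "\<And>\<epsilon> m n. 0 < \<epsilon> \<Longrightarrow>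
      (\<integral>x. \<rho> x * norm (G x) powr (p - 2) * (G x \<bullet> (compromise_s \<epsilon> (\<phi> m x) (\<phi> n x) *\<^sub>R g m x
          + compromise_t \<epsilon> (\<phi> m x) (\<phi> n x) *\<^sub>R g n x)) \<partial>M) =
      (\<integral>x. f x * compromise \<epsilon> (\<phi> m x) (\<phi> n x) \<partial>M)"
    and sign: "AE x in M. f x * u x \<le> \<kappa> * v x"
  shows "(\<integral>x. \<rho> x * norm (G x) powr p * (if u x = 0 then 0 else 1) \<partial>M) \<le> \<kappa> * (\<integral>x. v x \<partial>M)"
proof -
  define X where "X \<epsilon> n x = \<rho> x * norm (G x) powr (p - 2) *
      (G x \<bullet> (compromise_s \<epsilon> (u x) (\<phi> n x) *\<^sub>R G x + compromise_t \<epsilon> (u x) (\<phi> n x) *\<^sub>R g n x))" for \<epsilon> n x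
  define A where "A \<epsilon> s t = 2 * t\<^sup>2 / (s\<^sup>2 + t\<^sup>2 + \<epsilon>)" for \<epsilon> s t :: real
  have [measurable]: "v \<in> borel_measurable M" using v by auto
  have A_bound: "\<bar>c * A \<epsilon> s t\<bar> \<le> 2 * \<bar>c\<bar>" if "0 < \<epsilon>" for c \<epsilon> s t
  proof -
    have A: "0 \<le> A \<epsilon> s t" "A \<epsilon> s t \<le> 2"
      unfolding A_def by (fact quotient_bounds[OF that])+
    then show ?thesis
      using mult_left_mono[OF A(2), of "\<bar>c\<bar>"] by (simp add: abs_mult mult.commute)
  qed
  have step1: "(\<integral>x. X \<epsilon> n x \<partial>M) \<le> \<kappa> * (\<integral>x. v x * A \<epsilon> (u x) (\<phi> n x) \<partial>M)" if \<epsilon>: "0 < \<epsilon>" for \<epsilon> n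
  proof -
    have lhs: "(\<lambda>m. \<integral>x. \<rho> x * norm (G x) powr (p - 2) * (G x \<bullet> (compromise_s \<epsilon> (\<phi> m x) (\<phi> n x) *\<^sub>R g m x
          + compromise_t \<epsilon> (\<phi> m x) (\<phi> n x) *\<^sub>R g n x)) \<partial>M) \<longlonglongrightarrow> (\<integral>x. X \<epsilon> n x \<partial>M)"
    proof (rule integral_dominated_convergence)
      show "integrable M (\<lambda>x. 8 * \<Psi> x)" using \<Psi> by simp
      show "AE x in M. norm (\<rho> x * norm (G x) powr (p - 2) * (G x \<bullet> (compromise_s \<epsilon> (\<phi> m x) (\<phi> n x) *\<^sub>R g m x
          + compromise_t \<epsilon> (\<phi> m x) (\<phi> n x) *\<^sub>R g n x))) \<le> 8 * \<Psi> x" for m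
        using \<Psi>(2,3) \<rho>
      proof eventually_elim
        case (elim x)
        then show ?case
          unfolding real_norm_def
          by (intro duality_bound[OF p] abs_compromise_s_le[OF \<epsilon>] abs_compromise_t_le[OF \<epsilon>]) auto
      qed
      show "AE x in M. (\<lambda>m. \<rho> x * norm (G x) powr (p - 2) * (G x \<bullet> (compromise_s \<epsilon> (\<phi> m x) (\<phi> n x) *\<^sub>R g m x
          + compromise_t \<epsilon> (\<phi> m x) (\<phi> n x) *\<^sub>R g n x))) \<longlonglongrightarrow> X \<epsilon> n x"
        using \<phi> g unfolding X_def
        by eventually_elim (intro tendsto_intros tendsto_compromise[OF \<epsilon>])
    qed (auto simp: X_def[abs_def])
    have Hn: "integrable M (\<lambda>x. \<bar>f x * \<phi> n x\<bar>)" using f by auto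
    have fH: "(\<lambda>x. f x * compromise \<epsilon> (u x) (\<phi> n x)) \<in> borel_measurable M"
    proof -
      have [measurable]: "(\<lambda>x. f x * \<phi> n x) \<in> borel_measurable M" using f by auto
      \<comment> \<open>Measurability is known for the product \<open>f * \<phi> n\<close>, not for
        \<open>f\<close>, so one factor \<open>\<phi> n\<close> is split off from the
        compromise.\<close>
      have "(\<lambda>x. f x * compromise \<epsilon> (u x) (\<phi> n x)) =
          (\<lambda>x. (f x * \<phi> n x) * (2 * u x * \<phi> n x / ((u x)\<^sup>2 + (\<phi> n x)\<^sup>2 + \<epsilon>)))"
        by (simp add: compromise_def fun_eq_iff power2_eq_square)
      then show ?thesis by simp
    qed
    have cv: "AE x in M. (\<lambda>m. f x * compromise \<epsilon> (\<phi> m x) (\<phi> n x)) \<longlonglongrightarrow> f x * compromise \<epsilon> (u x) (\<phi> n x)"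
      using \<phi> by eventually_elim (intro tendsto_intros tendsto_compromise[OF \<epsilon>])
    have bd: "AE x in M. norm (f x * compromise \<epsilon> (\<phi> m x) (\<phi> n x)) \<le> \<bar>f x * \<phi> n x\<bar>" for m
      using abs_compromise_le[OF \<epsilon>] by (auto simp: abs_mult intro!: mult_left_mono)
    have rhs: "(\<lambda>m. \<integral>x. f x * compromise \<epsilon> (\<phi> m x) (\<phi> n x) \<partial>M) \<longlonglongrightarrow>
        (\<integral>x. f x * compromise \<epsilon> (u x) (\<phi> n x) \<partial>M)"
      by (rule integral_dominated_convergence[OF fH _ Hn cv bd]) (use f_test[OF \<epsilon>] in auto)
    have "integrable M (\<lambda>x. f x * compromise \<epsilon> (u x) (\<phi> n x))"
      by (rule integrable_dominated_convergence[OF fH _ Hn cv bd]) (use f_test[OF \<epsilon>] in auto)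
    moreover have "integrable M (\<lambda>x. v x * A \<epsilon> (u x) (\<phi> n x))"
    proof (rule Bochner_Integration.integrable_bound[where f = "\<lambda>x. 2 * v x"])
      show "AE x in M. norm (v x * A \<epsilon> (u x) (\<phi> n x)) \<le> norm (2 * v x)"
        using A_bound[OF \<epsilon>] by (intro AE_I2) (simp add: abs_mult[of 2])
    qed (use v in \<open>auto simp: A_def\<close>)
    moreover have "AE x in M. f x * compromise \<epsilon> (u x) (\<phi> n x) \<le> \<kappa> * (v x * A \<epsilon> (u x) (\<phi> n x))"
      using sign
    proof eventually_elim
      case (elim x)
      have "(f x * u x) * A \<epsilon> (u x) (\<phi> n x) \<le> (\<kappa> * v x) * A \<epsilon> (u x) (\<phi> n x)"
        using elim quotient_bounds[OF \<epsilon>] by (intro mult_right_mono) (auto simp: A_def)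
      then show ?case by (simp add: compromise_eq_quotient A_def mult.assoc)
    qed
    ultimately have "(\<integral>x. f x * compromise \<epsilon> (u x) (\<phi> n x) \<partial>M) \<le> (\<integral>x. \<kappa> * (v x * A \<epsilon> (u x) (\<phi> n x)) \<partial>M)"
      by (intro integral_mono_AE) auto
    then show ?thesis
      using LIMSEQ_unique[OF lhs] rhs test[OF \<epsilon>] by simp
  qed
  \<comment> \<open>The limit in \<open>n\<close>. On the right only \<open>v * A\<close> is left,
    dominated by \<open>2 * \<bar>v\<bar>\<close>, and \<open>A \<le> 1\<close> on the diagonal
    gives back the integral of \<open>v\<close>.\<close>
  have step2: "(\<integral>x. \<rho> x * norm (G x) powr p * (compromise_s \<epsilon> (u x) (u x) + compromise_t \<epsilon> (u x) (u x)) \<partial>M)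
      \<le> \<kappa> * (\<integral>x. v x \<partial>M)" if \<epsilon>: "0 < \<epsilon>" for \<epsilon>
  proof -
    let ?l = "\<lambda>x. \<rho> x * norm (G x) powr p * (compromise_s \<epsilon> (u x) (u x) + compromise_t \<epsilon> (u x) (u x))"
    have l: "?l x = \<rho> x * norm (G x) powr (p - 2) *
      (G x \<bullet> (compromise_s \<epsilon> (u x) (u x) *\<^sub>R G x + compromise_t \<epsilon> (u x) (u x) *\<^sub>R G x))" for x
      unfolding norm_powr_mult_inner_self[of "G x" p, symmetric]
      by (simp add: algebra_simps)
    have lhs: "(\<lambda>n. \<integral>x. X \<epsilon> n x \<partial>M) \<longlonglongrightarrow> (\<integral>x. ?l x \<partial>M)"
      unfolding l
    proof (rule integral_dominated_convergence)
      show "integrable M (\<lambda>x. 8 * \<Psi> x)" using \<Psi> by simp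
      show "AE x in M. norm (X \<epsilon> n x) \<le> 8 * \<Psi> x" for n
        using \<Psi>(2,3) \<rho>
      proof eventually_elim
        case (elim x)
        then show ?case
          unfolding real_norm_def X_def
          by (intro duality_bound[OF p] abs_compromise_s_le[OF \<epsilon>] abs_compromise_t_le[OF \<epsilon>]) auto
      qed
      show "AE x in M. (\<lambda>n. X \<epsilon> n x) \<longlonglongrightarrow> \<rho> x * norm (G x) powr (p - 2) *
          (G x \<bullet> (compromise_s \<epsilon> (u x) (u x) *\<^sub>R G x + compromise_t \<epsilon> (u x) (u x) *\<^sub>R G x))"
        using \<phi> g unfolding X_def
        by eventually_elim (intro tendsto_intros tendsto_compromise[OF \<epsilon>])
    qed (auto simp: X_def[abs_def])
    have rhs: "(\<lambda>n. \<integral>x. v x * A \<epsilon> (u x) (\<phi> n x) \<partial>M) \<longlonglongrightarrow> (\<integral>x. v x * A \<epsilon> (u x) (u x) \<partial>M)"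
    proof (rule integral_dominated_convergence)
      show "integrable M (\<lambda>x. 2 * \<bar>v x\<bar>)" using v by simp
      show "AE x in M. norm (v x * A \<epsilon> (u x) (\<phi> n x)) \<le> 2 * \<bar>v x\<bar>" for n
        using A_bound[OF \<epsilon>] by (intro AE_I2) simp
      show "AE x in M. (\<lambda>n. v x * A \<epsilon> (u x) (\<phi> n x)) \<longlonglongrightarrow> v x * A \<epsilon> (u x) (u x)"
        using \<phi> unfolding A_def
        by eventually_elim (intro tendsto_intros less_imp_neq[OF denominator_pos[OF \<epsilon>], symmetric])
    qed (auto simp: A_def)
    have "(\<integral>x. v x * A \<epsilon> (u x) (u x) \<partial>M) \<le> (\<integral>x. v x \<partial>M)"
    proof (rule integral_mono_AE')
      show "AE x in M. v x * A \<epsilon> (u x) (u x) \<le> v x"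
        using v(2)
      proof eventually_elim
        case (elim x)
        have "A \<epsilon> (u x) (u x) \<le> 1"
          unfolding A_def by (rule quotient_bounds(3)[OF \<epsilon>])
        then show ?case
          using mult_left_mono[of _ 1] elim by fastforce
      qed
    qed (use v in auto)
    then have "\<kappa> * (\<integral>x. v x * A \<epsilon> (u x) (u x) \<partial>M) \<le> \<kappa> * (\<integral>x. v x \<partial>M)"
      using \<kappa> by (rule mult_left_mono)
    moreover have "(\<integral>x. ?l x \<partial>M) \<le> \<kappa> * (\<integral>x. v x * A \<epsilon> (u x) (u x) \<partial>M)"
      by (rule LIMSEQ_le[OF lhs tendsto_mult_left[OF rhs]]) (use step1[OF \<epsilon>] in auto)
    ultimately show ?thesis by linarith
  qed
  \<comment> \<open>A positive null sequence for the limit in \<open>\<epsilon>\<close>; the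
    diagonal bound \<open>4\<close> supplies the majorant \<open>4 * \<Psi>\<close>.\<close>
  define e where "e n = inverse (real (Suc n))" for n
  have e: "e \<longlonglongrightarrow> 0" "0 < e n" for n
    unfolding e_def by (rule LIMSEQ_inverse_real_of_nat) simp
  have "(\<lambda>k. \<integral>x. \<rho> x * norm (G x) powr p * (compromise_s (e k) (u x) (u x) + compromise_t (e k) (u x) (u x)) \<partial>M)
     \<longlonglongrightarrow> (\<integral>x. \<rho> x * norm (G x) powr p * (if u x = 0 then 0 else 1) \<partial>M)"
  proof (rule integral_dominated_convergence)
    show "integrable M (\<lambda>x. 4 * \<Psi> x)" using \<Psi> by simp
    show "AE x in M. norm (\<rho> x * norm (G x) powr p *
        (compromise_s (e k) (u x) (u x) + compromise_t (e k) (u x) (u x))) \<le> 4 * \<Psi> x" for k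
      using \<Psi>(3) \<rho>
    proof eventually_elim
      case (elim x)
      have "(\<rho> x * norm (G x) powr p) * \<bar>compromise_s (e k) (u x) (u x) + compromise_t (e k) (u x) (u x)\<bar> \<le> \<Psi> x * 4"
        using elim compromise_diagonal[OF e(2)] by (intro mult_mono) (auto intro: order_trans[rotated])
      then show ?case using elim by (simp add: abs_mult)
    qed
    show "AE x in M. (\<lambda>k. \<rho> x * norm (G x) powr p * (compromise_s (e k) (u x) (u x) + compromise_t (e k) (u x) (u x)))
        \<longlonglongrightarrow> \<rho> x * norm (G x) powr p * (if u x = 0 then 0 else 1)"
      by (intro AE_I2 tendsto_mult_left compromise_diagonal_tendsto e)
  qed auto
  then show ?thesis
    by (rule LIMSEQ_le_const2) (use step2[OF e(2)] in auto)
qed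

section \<open>Elements of the completion\<close>

text \<open>The bound is the maximum of the left-hand side over \<open>t \<ge> 0\<close>. It comes
  from the inequality of weighted arithmetic and geometric means with weights
  \<open>x / (x + y)\<close> and \<open>y / (x + y)\<close>.\<close>

lemma power_difference_le:
  fixes L t x y :: real
  assumes x: "0 < x" and y: "0 < y" and L: "0 \<le> L" and t: "0 \<le> t"
  shows "L * t powr x - t powr (x + y) \<le>
    (L powr (x + y) * (x powr x * y powr y) / (x + y) powr (x + y)) powr (1 / y)"
    (is "_ \<le> ?\<mu>")
proof (cases "L = 0 \<or> t = 0")
  case False
  \<comment> \<open>Dividing by the weights makes the weighted arithmetic mean of \<open>a\<close>
    and \<open>b\<close> equal to \<open>t powr (x + y) + ?\<mu>\<close>. Their weighted geometric
    mean is \<open>L * t powr x\<close>, which is verified by comparing logarithms.\<close>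
  define a where "a = t powr (x + y) / (x / (x + y))"
  define b where "b = ?\<mu> / (y / (x + y))"
  have pos: "0 < t" "0 < L" "0 < x + y" using False L t x y by auto
  have \<mu>: "0 < ?\<mu>" using pos x y by simp
  have ab: "0 < a" "0 < b" using pos x y \<mu> by (auto simp: a_def b_def)
  have "a powr (x / (x + y)) * b powr (y / (x + y)) \<le> (x / (x + y)) * a + (y / (x + y)) * b"
    using x y ab by (intro Youngs_inequality_0) (auto simp: add_divide_distrib[symmetric])
  also have "\<dots> = t powr (x + y) + ?\<mu>"
    using x y pos by (simp add: a_def b_def)
  also have "a powr (x / (x + y)) * b powr (y / (x + y)) = L * t powr x"
  proof -
    have la: "ln a = (x + y) * ln t - (ln x - ln (x + y))"
      using pos x y by (simp add: a_def ln_div ln_powr ln_mult)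
    have "ln ?\<mu> = (1 / y) * ((x + y) * ln L + (x * ln x + y * ln y) - (x + y) * ln (x + y))"
      using pos x y by (simp add: ln_div ln_powr ln_mult)
    then have lb: "ln b = (1 / y) * ((x + y) * ln L + (x * ln x + y * ln y) - (x + y) * ln (x + y))
        - (ln y - ln (x + y))"
      using pos x y \<mu> by (simp add: b_def ln_div ln_mult)
    have "ln (a powr (x / (x + y)) * b powr (y / (x + y))) = x / (x + y) * ln a + y / (x + y) * ln b"
      using ab by (simp add: ln_mult ln_powr)
    also have "\<dots> = ln L + x * ln t"
      unfolding la lb using x y pos by (simp add: divide_simps) (simp add: algebra_simps)
    also have "\<dots> = ln (L * t powr x)"
      using pos by (simp add: ln_mult ln_powr)
    finally show ?thesis
      using ab pos by (subst (asm) ln_inj_iff) auto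
  qed
  finally show ?thesis by simp
qed auto

text \<open>Raising \<open>1 \<le> ?\<mu> * R\<close> to the power \<open>y\<close> cancels the
  outer exponent \<open>1 / y\<close> and contradicts \<open>small\<close> once denominators are
  cleared.\<close>

lemma smallness_imp_less_1:
  fixes L R x y :: real
  assumes x: "0 < x" and y: "0 < y" and R: "0 \<le> R"
    and small: "L powr (x + y) * R powr y < (x + y) powr (x + y) / (x powr x * y powr y)"
  shows "(L powr (x + y) * (x powr x * y powr y) / (x + y) powr (x + y)) powr (1 / y) * R < 1"
    (is "?\<mu> * R < 1")
proof (rule ccontr)
  let ?m = "L powr (x + y) * (x powr x * y powr y) / (x + y) powr (x + y)"
  assume "\<not> ?\<mu> * R < 1"
  then have "1 \<le> (?\<mu> * R) powr y"
    using y by (intro ge_one_powr_ge_zero) auto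
  also have "(?\<mu> * R) powr y = ?m powr (1 / y * y) * R powr y"
    using R by (simp only: powr_mult powr_powr)
  also have "?m powr (1 / y * y) = ?m"
    using y by simp
  finally have "(x + y) powr (x + y) \<le> L powr (x + y) * R powr y * (x powr x * y powr y)"
    using x y by (simp add: field_simps)
  moreover have "L powr (x + y) * R powr y * (x powr x * y powr y) < (x + y) powr (x + y)"
    using small x y by (simp add: field_simps)
  ultimately show False by simp
qed

section \<open>Measurability, integrability and approximation\<close>

text \<open>Integrability over bounded sets contains measurability: the weight is the pointwise
  limit of its truncations to half balls of radius \<open>n\<close>.\<close>

lemma admissible_weight_measurable:
  assumes "admissible_weight f"
  shows "f \<in> borel_measurable half_measure"
proof -
  have "(\<lambda>x. indicator half_space x *\<^sub>R f x) \<in> borel_measurable lebesgue"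
  proof (rule borel_measurable_LIMSEQ_real)
    show "(\<lambda>x. indicator (half_space \<inter> cball 0 (real n)) x *\<^sub>R f x) \<in> borel_measurable lebesgue" for n
    proof -
      have "half_space \<inter> cball 0 (real n) \<in> sets lebesgue"
        by (intro sets.Int half_space_sets) auto
      moreover have "bounded (half_space \<inter> cball 0 (real n))"
        by (rule bounded_subset[OF bounded_cball]) auto
      ultimately have "set_integrable lebesgue (half_space \<inter> cball 0 (real n)) f"
        using assms unfolding admissible_weight_def by blast
      then show ?thesis
        unfolding set_integrable_def by (rule borel_measurable_integrable)
    qed
    show "(\<lambda>n. indicator (half_space \<inter> cball 0 (real n)) x *\<^sub>R f x) \<longlonglongrightarrow> indicator half_space x *\<^sub>R f x" for x
    proof (rule tendsto_eventually)
      obtain k where "norm x \<le> real k" using real_arch_simple by blast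
      then show "\<forall>\<^sub>F n in sequentially. indicator (half_space \<inter> cball 0 (real n)) x *\<^sub>R f x = indicator half_space x *\<^sub>R f x"
        by (intro eventually_sequentiallyI[of k]) (auto simp: indicator_def)
    qed
  qed
  then show ?thesis
    by (subst borel_measurable_restrict_space_iff) auto
qed

lemma C_delta_measurable:
  fixes \<phi> :: "'m::finite space_N \<Rightarrow> real"
  assumes "\<phi> \<in> C_delta"
  shows "\<phi> \<in> borel_measurable half_measure" "grad \<phi> \<in> borel_measurable half_measure"
  using test_functions_D(3,4)[OF assms] by (auto intro!: continuous_imp_measurable_on_sets_lebesgue)

text \<open>The gradient is bounded on the compact support and zero outside it, and the weight is
  integrable over the bounded part of the half space that remains.\<close>

lemma C_delta_grad_powr_integrable:
  fixes \<phi> :: "'m::finite space_N \<Rightarrow> real"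
  assumes \<phi>: "\<phi> \<in> C_delta" and \<rho>: "admissible_weight \<rho>" and p: "1 < p"
  shows "integrable half_measure (\<lambda>x. \<rho> x * norm (grad \<phi> x) powr p)"
proof -
  let ?K = "closure {x. \<phi> x \<noteq> 0}"
  have K: "compact ?K"
    using \<phi> by (simp add: test_functions_def)
  have "bounded ((\<lambda>x. norm (grad \<phi> x) powr p) ` ?K)"
    using p by (intro compact_imp_bounded compact_continuous_image K continuous_on_powr'
        continuous_intros test_functions_D(3)[OF \<phi>]) auto
  then obtain B where B: "0 < B" "\<And>x. x \<in> ?K \<Longrightarrow> norm (grad \<phi> x) powr p \<le> B"
    by (auto simp: bounded_pos)
  have S: "half_space \<inter> ?K \<in> sets lebesgue"
    using K by (intro sets.Int half_space_sets) (auto intro: borel_closed)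
  have "bounded ?K" using K by (rule compact_imp_bounded)
  then have "set_integrable lebesgue (half_space \<inter> ?K) \<rho>"
    using \<rho> S unfolding admissible_weight_def by (auto intro: bounded_subset)
  then have int: "integrable lebesgue (\<lambda>x. B * (indicator (half_space \<inter> ?K) x *\<^sub>R \<rho> x))"
    unfolding set_integrable_def by (rule integrable_mult_right)
  have [measurable]: "\<rho> \<in> borel_measurable half_measure" "grad \<phi> \<in> borel_measurable half_measure"
    using admissible_weight_measurable[OF \<rho>] C_delta_measurable[OF \<phi>] by auto
  have m: "(\<lambda>x. \<rho> x * norm (grad \<phi> x) powr p) \<in> borel_measurable half_measure" by measurable
  have "integrable lebesgue (\<lambda>x. indicator half_space x *\<^sub>R (\<rho> x * norm (grad \<phi> x) powr p))"
  proof (rule Bochner_Integration.integrable_bound[OF int])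
    show "(\<lambda>x. indicator half_space x *\<^sub>R (\<rho> x * norm (grad \<phi> x) powr p)) \<in> borel_measurable lebesgue"
      using m by (subst (asm) borel_measurable_restrict_space_iff) auto
    have "norm (indicator half_space x *\<^sub>R (\<rho> x * norm (grad \<phi> x) powr p)) \<le>
        norm (B * (indicator (half_space \<inter> ?K) x *\<^sub>R \<rho> x))" for x
    proof (cases "x \<in> half_space \<and> x \<in> ?K")
      case True
      then show ?thesis
        using B mult_left_mono[OF B(2), of x "\<bar>\<rho> x\<bar>"] by (simp add: abs_mult mult.commute)
    next
      case False
      then show ?thesis
        using grad_eq_0_outside[of x \<phi>] p by (auto simp: indicator_def)
    qed
    then show "AE x in lebesgue. norm (indicator half_space x *\<^sub>R (\<rho> x * norm (grad \<phi> x) powr p)) \<le>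
        norm (B * (indicator (half_space \<inter> ?K) x *\<^sub>R \<rho> x))"
      by (rule AE_I2)
  qed
  then show ?thesis
    by (subst integrable_restrict_space) auto
qed

lemma weighted_powr_diff_le:
  fixes f h :: "'b::real_normed_vector"
  assumes "0 \<le> p" "0 \<le> c"
  shows "c * norm (f - h) powr p \<le> 2 powr p * (c * norm f powr p + c * norm h powr p)"
  using mult_left_mono[OF norm_powr_add_le[OF assms(1), of f "- h"] assms(2)]
  by (simp add: algebra_simps)

lemma weighted_powr_diff_integrable:
  fixes f h :: "'a \<Rightarrow> 'b::euclidean_space"
  assumes [measurable]: "c \<in> borel_measurable M" "f \<in> borel_measurable M" "h \<in> borel_measurable M"
    and "0 \<le> p" "AE x in M. 0 \<le> c x"
    and "integrable M (\<lambda>x. c x * norm (f x) powr p)" "integrable M (\<lambda>x. c x * norm (h x) powr p)"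
  shows "integrable M (\<lambda>x. c x * norm (f x - h x) powr p)"
proof (rule Bochner_Integration.integrable_bound)
  show "integrable M (\<lambda>x. 2 powr p * (c x * norm (f x) powr p + c x * norm (h x) powr p))"
    using assms by simp
  show "AE x in M. norm (c x * norm (f x - h x) powr p) \<le>
      norm (2 powr p * (c x * norm (f x) powr p + c x * norm (h x) powr p))"
    using assms(5)
  proof eventually_elim
    case (elim x)
    then show ?case
      using weighted_powr_diff_le[OF assms(4) elim, of "f x" "h x"] by (simp add: abs_mult)
  qed
qed measurable

lemma powr_null_imp_null:
  fixes I :: "nat \<Rightarrow> real"
  assumes "(\<lambda>n. I n powr r) \<longlonglongrightarrow> 0" "\<And>n. 0 \<le> I n" "0 < r"
  shows "I \<longlonglongrightarrow> 0"
proof -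
  have "(\<lambda>n. (I n powr r) powr (1 / r)) \<longlonglongrightarrow> 0 powr (1 / r)"
    using assms(1,3) by (intro tendsto_powr') (auto intro: always_eventually)
  then show ?thesis
    using assms by (simp add: powr_powr)
qed

lemma weighted_powr_null_imp_tendsto:
  fixes f :: "nat \<Rightarrow> 'b::real_normed_vector"
  assumes "(\<lambda>n. c * norm (f n - l) powr p) \<longlonglongrightarrow> 0" "0 < c" "0 < p"
  shows "f \<longlonglongrightarrow> l"
proof -
  have "(\<lambda>n. (1 / c) * (c * norm (f n - l) powr p)) \<longlonglongrightarrow> (1 / c) * 0"
    by (intro tendsto_intros assms)
  then have "(\<lambda>n. norm (f n - l) powr p) \<longlonglongrightarrow> 0"
    using assms by simp
  then have "(\<lambda>n. norm (f n - l)) \<longlonglongrightarrow> 0"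
    by (rule powr_null_imp_null) (use assms in auto)
  then show ?thesis
    by (simp add: LIM_zero_cancel tendsto_norm_zero_iff)
qed

text \<open>The errors of function and gradient are added into one null sequence in
  \<open>L^1\<close>, so a single subsequence serves both. The majorants come from
  \<open>weighted_powr_diff_le\<close>, each approximant being its error plus the limit.\<close>

lemma E_approximation:
  fixes u :: "'m::finite space_N \<Rightarrow> real"
  assumes p: "1 < p" and \<rho>: "admissible_weight \<rho>" and E: "in_E_with_gradient p \<gamma> \<rho> u G"
  obtains \<phi> \<Phi> \<Psi> where "\<And>n. \<phi> n \<in> C_delta"
    "integrable half_measure \<Phi>" "integrable half_measure \<Psi>"
    "AE x in half_measure. (\<lambda>n. \<phi> n x) \<longlonglongrightarrow> u x"
    "AE x in half_measure. (\<lambda>n. grad (\<phi> n) x) \<longlonglongrightarrow> G x"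
    "AE x in half_measure. \<forall>n. (1 + snd x) powr (\<gamma> - p) * \<bar>\<phi> n x\<bar> powr p \<le> \<Phi> x"
    "AE x in half_measure. \<forall>n. \<rho> x * norm (grad (\<phi> n) x) powr p \<le> \<Psi> x"
    "AE x in half_measure. \<rho> x * norm (G x) powr p \<le> \<Psi> x"
proof -
  let ?w = "\<lambda>x::'m space_N. (1 + snd x) powr (\<gamma> - p)"
  obtain \<phi> where \<phi>: "\<And>n. \<phi> n \<in> C_delta"
    and cu: "(\<lambda>n. Lp_norm p ?w (\<lambda>x. \<phi> n x - u x)) \<longlonglongrightarrow> 0"
    and cG: "(\<lambda>n. Lp_norm p \<rho> (\<lambda>x. grad (\<phi> n) x - G x)) \<longlonglongrightarrow> 0"
    using E unfolding in_E_with_gradient_def by auto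
  have \<rho>_pos: "0 < \<rho> x" if "x \<in> half_space" for x
    using \<rho> that by (auto simp: admissible_weight_def)
  have "continuous_on half_space ?w"
    by (intro continuous_intros) (auto simp: half_space_def)
  then have [measurable]: "?w \<in> borel_measurable half_measure"
    by (intro continuous_imp_measurable_on_sets_lebesgue half_space_sets)
  have [measurable]: "\<rho> \<in> borel_measurable half_measure"
    by (rule admissible_weight_measurable[OF \<rho>])
  have [measurable]: "u \<in> borel_measurable half_measure" "G \<in> borel_measurable half_measure"
    and iu: "integrable half_measure (\<lambda>x. ?w x * norm (u x) powr p)"
    and iG: "integrable half_measure (\<lambda>x. \<rho> x * norm (G x) powr p)"
    using E unfolding in_E_with_gradient_def Lp_weighted_def by auto
  note [measurable] = C_delta_measurable[OF \<phi>]
  \<comment> \<open>The integral in \<open>Lp_norm\<close> is \<open>0\<close> by default for a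
    non-integrable difference; with integrability secured, \<open>cu\<close> and \<open>cG\<close>
    express genuine convergence.\<close>
  have i1: "integrable half_measure (\<lambda>x. ?w x * norm (\<phi> n x - u x) powr p)" for n
    using p iu C_delta_powr_integrable(1)[OF \<phi> p]
    by (intro weighted_powr_diff_integrable) (auto simp: C_delta_measurable[OF \<phi>])
  have i2: "integrable half_measure (\<lambda>x. \<rho> x * norm (grad (\<phi> n) x - G x) powr p)" for n
    using p iG C_delta_grad_powr_integrable[OF \<phi> \<rho> p] \<rho>_pos
    by (intro weighted_powr_diff_integrable)
       (auto simp: C_delta_measurable[OF \<phi>] intro!: AE_I2 less_imp_le)
  \<comment> \<open>The absolute value makes \<open>F\<close> nonnegative at every point, as
    \<open>L1_null_dominated_subseq\<close> asks; the sign of \<open>\<rho>\<close> is known inside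
    the half space only.\<close>
  define F where "F n x = ?w x * norm (\<phi> n x - u x) powr p + \<bar>\<rho> x * norm (grad (\<phi> n) x - G x) powr p\<bar>" for n x
  have F_abs: "(\<integral>x. \<bar>\<rho> x * norm (grad (\<phi> n) x - G x) powr p\<bar> \<partial>half_measure) =
       (\<integral>x. \<rho> x * norm (grad (\<phi> n) x - G x) powr p \<partial>half_measure)" for n
    using \<rho>_pos by (intro Bochner_Integration.integral_cong refl) (simp add: less_imp_le)
  have iF: "integrable half_measure (F n)" for n
    unfolding F_def by (intro Bochner_Integration.integrable_add i1 integrable_abs i2)
  have l1: "(\<lambda>n. \<integral>x. ?w x * norm (\<phi> n x - u x) powr p \<partial>half_measure) \<longlonglongrightarrow> 0"
    by (rule powr_null_imp_null[OF cu[unfolded Lp_norm_def]]) (use p in auto)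
  have l2: "(\<lambda>n. \<integral>x. \<rho> x * norm (grad (\<phi> n) x - G x) powr p \<partial>half_measure) \<longlonglongrightarrow> 0"
  proof (rule powr_null_imp_null[OF cG[unfolded Lp_norm_def]])
    show "0 \<le> (\<integral>x. \<rho> x * norm (grad (\<phi> n) x - G x) powr p \<partial>half_measure)" for n
      using \<rho>_pos by (intro Bochner_Integration.integral_nonneg mult_nonneg_nonneg) (auto intro: less_imp_le)
  qed (use p in auto)
  have lF: "(\<lambda>n. \<integral>x. F n x \<partial>half_measure) \<longlonglongrightarrow> 0"
    unfolding F_def using tendsto_add[OF l1 l2] i1 i2 by (simp add: F_abs)
  have F0: "0 \<le> F n x" for n x
    by (simp add: F_def)
  obtain r h where r: "strict_mono r" and h: "integrable half_measure h"
    and c: "AE x in half_measure. (\<lambda>n. F (r n) x) \<longlonglongrightarrow> 0"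
    and b: "AE x in half_measure. \<forall>n. F (r n) x \<le> h x"
    by (rule L1_null_dominated_subseq[OF iF F0 lF])
  have sp: "AE x in half_measure. x \<in> half_space"
    by (intro AE_I2) simp
  show ?thesis
  proof (rule that[of "\<lambda>n. \<phi> (r n)" "\<lambda>x. 2 powr p * (h x + ?w x * norm (u x) powr p)"
        "\<lambda>x. 2 powr p * (h x + \<rho> x * norm (G x) powr p)"])
    show "AE x in half_measure. (\<lambda>n. \<phi> (r n) x) \<longlonglongrightarrow> u x"
      using c sp
    proof eventually_elim
      case (elim x)
      have lim: "(\<lambda>n. ?w x * norm (\<phi> (r n) x - u x) powr p) \<longlonglongrightarrow> 0"
        by (rule tendsto_sandwich[OF _ _ tendsto_const elim(1)]) (auto simp: F_def)
      show ?case
        by (rule weighted_powr_null_imp_tendsto[OF lim]) (use p elim(2) in \<open>auto simp: half_space_def\<close>)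
    qed
    show "AE x in half_measure. (\<lambda>n. grad (\<phi> (r n)) x) \<longlonglongrightarrow> G x"
      using c sp
    proof eventually_elim
      case (elim x)
      have lim: "(\<lambda>n. \<rho> x * norm (grad (\<phi> (r n)) x - G x) powr p) \<longlonglongrightarrow> 0"
        using \<rho>_pos[OF elim(2)]
        by (intro tendsto_sandwich[OF _ _ tendsto_const elim(1)]) (auto simp: F_def)
      show ?case
        by (rule weighted_powr_null_imp_tendsto[OF lim]) (use p \<rho>_pos[OF elim(2)] in auto)
    qed
    show "AE x in half_measure. \<forall>n. ?w x * \<bar>\<phi> (r n) x\<bar> powr p \<le> 2 powr p * (h x + ?w x * norm (u x) powr p)"
      using b
    proof eventually_elim
      case (elim x)
      show ?case
      proof
        fix n
        have "?w x * norm (\<phi> (r n) x - u x) powr p \<le> F (r n) x"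
          by (simp add: F_def)
        then have "?w x * norm (\<phi> (r n) x - u x) powr p \<le> h x"
          using elim order_trans by blast
        then have "2 powr p * (?w x * norm (\<phi> (r n) x - u x) powr p + ?w x * norm (u x) powr p) \<le>
            2 powr p * (h x + ?w x * norm (u x) powr p)"
          by (intro mult_left_mono) auto
        then show "?w x * \<bar>\<phi> (r n) x\<bar> powr p \<le> 2 powr p * (h x + ?w x * norm (u x) powr p)"
          by (rule order_trans[rotated]) (use weighted_powr_diff_le[of p "?w x" "\<phi> (r n) x - u x" "- u x"] p in simp)
      qed
    qed
    show "AE x in half_measure. \<forall>n. \<rho> x * norm (grad (\<phi> (r n)) x) powr p \<le> 2 powr p * (h x + \<rho> x * norm (G x) powr p)"
      using b sp
    proof eventually_elim
      case (elim x)
      show ?case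
      proof
        fix n
        have "\<rho> x * norm (grad (\<phi> (r n)) x - G x) powr p \<le> F (r n) x"
          unfolding F_def by (rule order_trans[OF abs_ge_self]) simp
        then have "\<rho> x * norm (grad (\<phi> (r n)) x - G x) powr p \<le> h x"
          using elim order_trans by blast
        then have "2 powr p * (\<rho> x * norm (grad (\<phi> (r n)) x - G x) powr p + \<rho> x * norm (G x) powr p) \<le>
            2 powr p * (h x + \<rho> x * norm (G x) powr p)"
          by (intro mult_left_mono) auto
        then show "\<rho> x * norm (grad (\<phi> (r n)) x) powr p \<le> 2 powr p * (h x + \<rho> x * norm (G x) powr p)"
          by (rule order_trans[rotated])
             (use weighted_powr_diff_le[of p "\<rho> x" "grad (\<phi> (r n)) x - G x" "- G x"] p \<rho>_pos[OF elim(2)] in simp)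
      qed
    qed
    show "AE x in half_measure. \<rho> x * norm (G x) powr p \<le> 2 powr p * (h x + \<rho> x * norm (G x) powr p)"
      using b sp
    proof eventually_elim
      case (elim x)
      have "0 \<le> h x"
        using F0[of "r 0" x] elim(1) order_trans by blast
      moreover have "0 \<le> \<rho> x * norm (G x) powr p"
        using \<rho>_pos[OF elim(2)] by simp
      moreover have "1 \<le> 2 powr p"
        using p by (intro ge_one_powr_ge_zero) auto
      ultimately show ?case
        using mult_mono[of 1 "2 powr p" "\<rho> x * norm (G x) powr p" "h x + \<rho> x * norm (G x) powr p"] by simp
    qed
  qed (use \<phi> h iu iG in auto)
qed

section \<open>Nonexistence\<close>

text \<open>\<open>C_delta_hardy\<close> passes to the limit along the approximants. Only then is
  Young's inequality applied: the factor \<open>\<bar>u\<bar> powr (p - 1)\<close> confines the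
  gradient term to the set where \<open>u\<close> is nonzero, and the share \<open>1 - 1/p\<close>
  of the left-hand side is absorbed.\<close>

lemma E_hardy:
  fixes u :: "'m::finite space_N \<Rightarrow> real"
  assumes p: "1 < p" and \<gamma>: "p - 1 < \<gamma>" and \<rho>: "admissible_weight \<rho>" and \<rho>0: "0 < \<rho>0"
    and rho_lower: "AE x in half_measure. \<rho> x \<ge> \<rho>0 * (1 + snd x) powr \<gamma>"
    and E: "in_E_with_gradient p \<gamma> \<rho> u G"
  shows "(\<integral>x. (1 + snd x) powr (\<gamma> - p) * \<bar>u x\<bar> powr p \<partial>half_measure) \<le>
    hardy_const p \<gamma> powr (- p) / \<rho>0 *
      (\<integral>x. \<rho> x * norm (G x) powr p * (if u x = 0 then 0 else 1) \<partial>half_measure)"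
proof -
  obtain \<phi> \<Phi> \<Psi> where \<phi>: "\<And>n. \<phi> n \<in> C_delta"
    and \<Phi>: "integrable half_measure \<Phi>" and \<Psi>: "integrable half_measure \<Psi>"
    and cu: "AE x in half_measure. (\<lambda>n. \<phi> n x) \<longlonglongrightarrow> u x"
    and cG: "AE x in half_measure. (\<lambda>n. grad (\<phi> n) x) \<longlonglongrightarrow> G x"
    and bu: "AE x in half_measure. \<forall>n. (1 + snd x) powr (\<gamma> - p) * \<bar>\<phi> n x\<bar> powr p \<le> \<Phi> x"
    and bg: "AE x in half_measure. \<forall>n. \<rho> x * norm (grad (\<phi> n) x) powr p \<le> \<Psi> x"
    and bG: "AE x in half_measure. \<rho> x * norm (G x) powr p \<le> \<Psi> x"
    by (rule E_approximation[OF p \<rho> E]) (rule that; assumption)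
  define C where "C = hardy_const p \<gamma>"
  have C: "0 < C" "p * C = \<gamma> - p + 1" using p \<gamma> by (auto simp: C_def hardy_const_def)
  let ?w = "\<lambda>x::'m space_N. (1 + snd x) powr (\<gamma> - p)"
  let ?c = "\<lambda>x::'m space_N. (1 + snd x) powr (\<gamma> - p + 1)"
  have wmeas: "(\<lambda>x::'m space_N. (1 + snd x) powr \<alpha>) \<in> borel_measurable half_measure" for \<alpha>
  proof -
    have "continuous_on half_space (\<lambda>x::'m space_N. (1 + snd x) powr \<alpha>)"
      by (intro continuous_intros) (auto simp: half_space_def)
    then show ?thesis
      by (intro continuous_imp_measurable_on_sets_lebesgue half_space_sets)
  qed
  note [measurable] = wmeas C_delta_measurable[OF \<phi>]
  have [measurable]: "\<rho> \<in> borel_measurable half_measure"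
    by (rule admissible_weight_measurable[OF \<rho>])
  have [measurable]: "u \<in> borel_measurable half_measure" "G \<in> borel_measurable half_measure"
    and iu: "integrable half_measure (\<lambda>x. ?w x * \<bar>u x\<bar> powr p)"
    and iG: "integrable half_measure (\<lambda>x. \<rho> x * norm (G x) powr p)"
    using E unfolding in_E_with_gradient_def Lp_weighted_def by auto
  have sp: "AE x in half_measure. x \<in> half_space"
    by (intro AE_I2) simp
  \<comment> \<open>The exponent of the weight splits as
    \<open>(\<gamma> - p) / p * (p - 1) + \<gamma> / p\<close>, which matches the weights of the two
    \<open>p\<close>-th powers. Dividing the gradient factor by \<open>C\<close> costs a factor
    \<open>C\<close> in front, the same as on the left of Hardy's inequality, and yields
    \<open>C powr (- p)\<close>.\<close>
  have young: "?c x * a powr (p - 1) * b \<le>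
      C * ((1 - 1/p) * (?w x * a powr p) + 1/p * (C powr (- p) / \<rho>0) * (r * b powr p))"
    if x: "x \<in> half_space" and r: "\<rho>0 * (1 + snd x) powr \<gamma> \<le> r" and ab: "0 \<le> a" "0 \<le> b"
    for x :: "'m space_N" and a b r :: real
  proof -
    define y where "y = 1 + snd x"
    have y: "0 < y" using x by (simp add: half_space_def y_def)
    let ?X = "y powr ((\<gamma> - p) / p) * a" and ?Y = "y powr (\<gamma> / p) * b / C"
    have "y powr (\<gamma> - p + 1) * a powr (p - 1) * b = C * (?X powr (p - 1) * ?Y)"
    proof -
      have e: "\<gamma> - p + 1 = (\<gamma> - p) / p * (p - 1) + \<gamma> / p"
        using p by (simp add: field_simps)
      show ?thesis
        unfolding e powr_add using C ab y by (simp add: powr_mult powr_powr)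
    qed
    also have "\<dots> \<le> C * ((1 - 1/p) * ?X powr p + 1/p * ?Y powr p)"
      using C ab y p by (intro mult_left_mono powr_Young) auto
    also have "?X powr p = y powr (\<gamma> - p) * a powr p"
      using p ab y by (simp add: powr_mult powr_powr)
    also have "?Y powr p = C powr (- p) * (y powr \<gamma> * b powr p)"
      using p ab y C by (simp add: powr_mult powr_powr powr_divide powr_minus_divide)
    also have "C * ((1 - 1/p) * (y powr (\<gamma> - p) * a powr p) + 1/p * (C powr (- p) * (y powr \<gamma> * b powr p))) \<le>
       C * ((1 - 1/p) * (y powr (\<gamma> - p) * a powr p) + 1/p * (C powr (- p) / \<rho>0) * (r * b powr p))"
    proof -
      have "y powr \<gamma> * b powr p \<le> r / \<rho>0 * b powr p"
        using r \<rho>0 by (intro mult_right_mono) (auto simp: y_def field_simps)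
      then have "1/p * C powr (- p) * (y powr \<gamma> * b powr p) \<le> 1/p * C powr (- p) * (r / \<rho>0 * b powr p)"
        using p by (intro mult_left_mono) auto
      then show ?thesis
        using C by (intro mult_left_mono add_left_mono) (auto simp: mult.assoc)
    qed
    finally show ?thesis by (simp add: y_def)
  qed
  let ?W = "\<integral>x. ?w x * \<bar>u x\<bar> powr p \<partial>half_measure"
  let ?K = "\<integral>x. ?c x * \<bar>u x\<bar> powr (p - 1) * norm (G x) \<partial>half_measure"
  let ?J = "\<integral>x. \<rho> x * norm (G x) powr p * (if u x = 0 then 0 else 1) \<partial>half_measure"
  have lW: "(\<lambda>n. \<integral>x. ?w x * \<bar>\<phi> n x\<bar> powr p \<partial>half_measure) \<longlonglongrightarrow> ?W"
  proof (rule integral_dominated_convergence[OF _ _ \<Phi>])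
    show "AE x in half_measure. (\<lambda>n. ?w x * \<bar>\<phi> n x\<bar> powr p) \<longlonglongrightarrow> ?w x * \<bar>u x\<bar> powr p"
      using cu by eventually_elim (use p in \<open>auto intro!: tendsto_intros tendsto_powr'\<close>)
    show "AE x in half_measure. norm (?w x * \<bar>\<phi> n x\<bar> powr p) \<le> \<Phi> x" for n
      using bu by eventually_elim simp
  qed measurable
  \<comment> \<open>The right-hand side of \<open>young\<close> with the two \<open>p\<close>-th
    powers replaced by their majorants.\<close>
  let ?D = "\<lambda>x. C * ((1 - 1/p) * \<Phi> x + 1/p * (C powr (- p) / \<rho>0) * \<Psi> x)"
  have D: "integrable half_measure ?D"
    using \<Phi> \<Psi> by simp
  have conv: "AE x in half_measure. (\<lambda>n. ?c x * \<bar>\<phi> n x\<bar> powr (p - 1) * norm (grad (\<phi> n) x)) \<longlonglongrightarrow>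
        ?c x * \<bar>u x\<bar> powr (p - 1) * norm (G x)"
    using cu cG by eventually_elim (use p in \<open>auto intro!: tendsto_intros tendsto_powr'\<close>)
  have bound: "AE x in half_measure. norm (?c x * \<bar>\<phi> n x\<bar> powr (p - 1) * norm (grad (\<phi> n) x)) \<le> ?D x" for n
    using bu bg rho_lower sp
  proof eventually_elim
    case (elim x)
    have "norm (?c x * \<bar>\<phi> n x\<bar> powr (p - 1) * norm (grad (\<phi> n) x)) =
        ?c x * \<bar>\<phi> n x\<bar> powr (p - 1) * norm (grad (\<phi> n) x)"
      by simp
    also have "\<dots> \<le> C * ((1 - 1/p) * (?w x * \<bar>\<phi> n x\<bar> powr p) +
        1/p * (C powr (- p) / \<rho>0) * (\<rho> x * norm (grad (\<phi> n) x) powr p))"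
      using elim by (intro young) auto
    also have "\<dots> \<le> ?D x"
      using elim C p \<rho>0 by (intro mult_left_mono add_mono) auto
    finally show ?case .
  qed
  have lK: "(\<lambda>n. \<integral>x. ?c x * \<bar>\<phi> n x\<bar> powr (p - 1) * norm (grad (\<phi> n) x) \<partial>half_measure) \<longlonglongrightarrow> ?K"
    by (rule integral_dominated_convergence[OF _ _ D conv bound]) measurable
  have iK: "integrable half_measure (\<lambda>x. ?c x * \<bar>u x\<bar> powr (p - 1) * norm (G x))"
    by (rule integrable_dominated_convergence[OF _ _ D conv bound]) measurable
  have "p * C * ?W \<le> p * ?K"
    using C(2) C_delta_hardy[OF \<phi> p \<gamma>]
    by (intro LIMSEQ_le[OF tendsto_mult_left[OF lW] tendsto_mult_left[OF lK]]) auto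
  then have hardy: "C * ?W \<le> ?K"
    using p by (simp add: mult.assoc)
  have iJ: "integrable half_measure (\<lambda>x. \<rho> x * norm (G x) powr p * (if u x = 0 then 0 else 1))"
    by (rule Bochner_Integration.integrable_bound[OF iG]) auto
  \<comment> \<open>Where \<open>u x = 0\<close>, the left integrand is \<open>0\<close> since
    \<open>0 powr (p - 1) = 0\<close>, so the gradient term may carry the indicator.\<close>
  have "?K \<le> (\<integral>x. C * ((1 - 1/p) * (?w x * \<bar>u x\<bar> powr p) + 1/p * (C powr (- p) / \<rho>0) *
      (\<rho> x * norm (G x) powr p * (if u x = 0 then 0 else 1))) \<partial>half_measure)"
  proof (rule integral_mono_AE[OF iK])
    show "AE x in half_measure. ?c x * \<bar>u x\<bar> powr (p - 1) * norm (G x) \<le> C * ((1 - 1/p) * (?w x * \<bar>u x\<bar> powr p) +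
        1/p * (C powr (- p) / \<rho>0) * (\<rho> x * norm (G x) powr p * (if u x = 0 then 0 else 1)))"
      using rho_lower sp
    proof eventually_elim
      case (elim x)
      then show ?case
        using young[of x "\<rho> x" "\<bar>u x\<bar>" "norm (G x)"] by (cases "u x = 0") auto
    qed
  qed (use iu iJ in simp)
  also have "\<dots> = C * ((1 - 1/p) * ?W + 1/p * (C powr (- p) / \<rho>0) * ?J)"
    using iu iJ by simp
  finally have "C * ?W \<le> C * ((1 - 1/p) * ?W + 1/p * (C powr (- p) / \<rho>0) * ?J)"
    using hardy by linarith
  then have "?W \<le> (1 - 1/p) * ?W + 1/p * (C powr (- p) / \<rho>0) * ?J"
    using C by (simp only: mult_le_cancel_left_pos)
  then have "1/p * ?W \<le> 1/p * (C powr (- p) / \<rho>0 * ?J)"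
    by (simp add: algebra_simps)
  then show ?thesis
    using p unfolding C_def by (subst (asm) mult_le_cancel_left_pos) auto
qed

text \<open>Membership in \<open>Linf\<close> makes the essential supremum finite, so
  \<open>real_of_ereal\<close> keeps its value instead of returning the default
  \<open>0\<close>.\<close>

lemma Linf_norm_bound:
  assumes "f \<in> Linf"
  shows "AE x in half_measure. \<bar>f x\<bar> \<le> Linf_norm f"
  using esssup_AE[of "\<lambda>x. ereal \<bar>f x\<bar>" half_measure]
proof eventually_elim
  case (elim x)
  have "esssup half_measure (\<lambda>x. ereal \<bar>f x\<bar>) < \<infinity>"
    using assms by (simp add: Linf_def)
  with elim show ?case
    unfolding Linf_norm_def by (cases "esssup half_measure (\<lambda>x. ereal \<bar>f x\<bar>)") auto
qed

text \<open>Testing gives \<open>?J \<le> (\<mu> * b0) * ?V\<close> and Hardy's inequality gives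
  \<open>?V \<le> c * ?J\<close>. Smallness makes the product of the constants less than
  \<open>1\<close>, which forces \<open>?V = 0\<close>.\<close>

lemma weak_solution_imp_zero:
  fixes \<rho> a b u :: "'m::finite space_N \<Rightarrow> real"
  assumes p: "1 < p" and pq: "p < q" and qs: "q < s"
    and \<rho>: "admissible_weight \<rho>" and b: "admissible_weight b"
    and \<rho>0: "\<rho>0 > 0" and \<gamma>: "\<gamma> > p - 1"
    and rho_lower: "AE x in half_measure. \<rho> x \<ge> \<rho>0 * (1 + snd x) powr \<gamma>"
    and b0: "b0 > 0"
    and b_upper: "\<And>x. x \<in> half_space \<Longrightarrow> b x * (1 + snd x) powr (p - \<gamma>) \<le> b0"
    and ab_in: "(\<lambda>x. a x / b x) \<in> Linf"
    and small:
      "Linf_norm (\<lambda>x. a x / b x) powr (s - p) *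
         (b0 * hardy_const p \<gamma> powr (- p) / \<rho>0) powr (s - q)
       < (s - p) powr (s - p) / ((q - p) powr (q - p) * (s - q) powr (s - q))"
    and sol: "weak_solution p q s \<gamma> \<rho> a b u"
  shows "AE x in half_measure. u x = 0"
proof -
  define f where "f x = a x * \<bar>u x\<bar> powr (q - 2) * u x - b x * \<bar>u x\<bar> powr (s - 2) * u x" for x
  define v where "v x = (1 + snd x) powr (\<gamma> - p) * \<bar>u x\<bar> powr p" for x
  define \<Lambda> where "\<Lambda> = Linf_norm (\<lambda>x. a x / b x)"
  \<comment> \<open>The bound of \<open>power_difference_le\<close> for
    \<open>L = \<Lambda>\<close>, \<open>x = q - p\<close> and \<open>y = s - q\<close>, so that
    \<open>x + y = s - p\<close>.\<close>
  define \<mu> where "\<mu> = (\<Lambda> powr (s - p) * ((q - p) powr (q - p) * (s - q) powr (s - q)) / (s - p) powr (s - p)) powr (1 / (s - q))"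
  obtain G where E: "in_E_with_gradient p \<gamma> \<rho> u G"
    and weak: "\<And>\<phi>. \<phi> \<in> C_delta \<Longrightarrow> integrable half_measure (\<lambda>x. f x * \<phi> x)"
      "\<And>\<phi>. \<phi> \<in> C_delta \<Longrightarrow> (\<integral>x. \<rho> x * norm (G x) powr (p - 2) * (G x \<bullet> grad \<phi> x) \<partial>half_measure) =
           (\<integral>x. f x * \<phi> x \<partial>half_measure)"
    using sol unfolding weak_solution_def f_def by blast
  have \<rho>_pos: "0 < \<rho> x" if "x \<in> half_space" for x
    using \<rho> that by (auto simp: admissible_weight_def)
  have sp: "AE x in half_measure. x \<in> half_space"
    by (intro AE_I2) simp
  have meas: "\<rho> \<in> borel_measurable half_measure" "u \<in> borel_measurable half_measure" "G \<in> borel_measurable half_measure"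
    and iv: "integrable half_measure v"
    using E admissible_weight_measurable[OF \<rho>] unfolding in_E_with_gradient_def Lp_weighted_def v_def by auto
  have v0: "0 \<le> v x" for x
    by (simp add: v_def)
  \<comment> \<open>With \<open>\<bar>u\<bar> powr p\<close> factored out,
    \<open>a \<le> \<Lambda> * b\<close> and the scalar inequality at
    \<open>t = \<bar>u x\<bar>\<close> leave \<open>b * \<mu>\<close>; the upper bound on
    \<open>b\<close> then supplies the Hardy weight.\<close>
  have sign: "AE x in half_measure. f x * u x \<le> (\<mu> * b0) * v x"
    using Linf_norm_bound[OF ab_in] sp
  proof eventually_elim
    case (elim x)
    have bx: "0 < b x" using b elim(2) by (auto simp: admissible_weight_def)
    have y: "0 < 1 + snd x" using elim(2) by (simp add: half_space_def)
    have L: "0 \<le> \<Lambda>"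
      using order_trans[OF abs_ge_zero elim(1)] by (simp add: \<Lambda>_def)
    have aL: "a x \<le> \<Lambda> * b x"
      using elim(1) bx unfolding \<Lambda>_def by (auto simp: abs_le_iff divide_simps)
    have pw: "\<bar>u x\<bar> powr (r - 2) * u x * u x = \<bar>u x\<bar> powr p * \<bar>u x\<bar> powr (r - p)" for r
      using norm_powr_mult_inner_self[of "u x" r] by (simp flip: powr_add add: mult.assoc)
    have "f x * u x = \<bar>u x\<bar> powr p * (a x * \<bar>u x\<bar> powr (q - p) - b x * \<bar>u x\<bar> powr (s - p))"
      using pw[of q] pw[of s] unfolding f_def by (simp add: algebra_simps)
    also have "a x * \<bar>u x\<bar> powr (q - p) - b x * \<bar>u x\<bar> powr (s - p) \<le>
        b x * (\<Lambda> * \<bar>u x\<bar> powr (q - p) - \<bar>u x\<bar> powr (s - p))"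
      using mult_right_mono[OF aL, of "\<bar>u x\<bar> powr (q - p)"] by (simp add: algebra_simps)
    also have "\<dots> \<le> b x * \<mu>"
      using power_difference_le[of "q - p" "s - q" \<Lambda> "\<bar>u x\<bar>"] pq qs L bx
      unfolding \<mu>_def by (intro mult_left_mono) auto
    also have "b x \<le> b0 * (1 + snd x) powr (\<gamma> - p)"
      using mult_right_mono[OF b_upper[OF elim(2)], of "(1 + snd x) powr (\<gamma> - p)"] y
      by (simp add: mult.assoc flip: powr_add)
    finally show ?case
      by (simp add: v_def \<mu>_def mult_left_mono mult_right_mono algebra_simps)
  qed
  let ?J = "\<integral>x. \<rho> x * norm (G x) powr p * (if u x = 0 then 0 else 1) \<partial>half_measure"
  let ?V = "\<integral>x. v x \<partial>half_measure"
  obtain \<phi> \<Phi> \<Psi> where \<phi>: "\<And>n. \<phi> n \<in> C_delta"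
    and \<Phi>: "integrable half_measure \<Phi>" and \<Psi>: "integrable half_measure \<Psi>"
    and cu: "AE x in half_measure. (\<lambda>n. \<phi> n x) \<longlonglongrightarrow> u x"
    and cG: "AE x in half_measure. (\<lambda>n. grad (\<phi> n) x) \<longlonglongrightarrow> G x"
    and bu: "AE x in half_measure. \<forall>n. (1 + snd x) powr (\<gamma> - p) * \<bar>\<phi> n x\<bar> powr p \<le> \<Phi> x"
    and bg: "AE x in half_measure. \<forall>n. \<rho> x * norm (grad (\<phi> n) x) powr p \<le> \<Psi> x"
    and bG: "AE x in half_measure. \<rho> x * norm (G x) powr p \<le> \<Psi> x"
    by (rule E_approximation[OF p \<rho> E]) (rule that; assumption)
  have J: "?J \<le> (\<mu> * b0) * ?V"
  proof (rule testing_limit[OF meas C_delta_measurable[OF \<phi>] p _ _ iv _ \<Psi> bg bG cu cG weak(1)[OF \<phi>] _ _ sign])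
    show "0 \<le> \<mu> * b0" using b0 by (simp add: \<mu>_def)
    show "AE x in half_measure. 0 \<le> \<rho> x" using \<rho>_pos by (intro AE_I2) (auto intro: less_imp_le)
    show "AE x in half_measure. 0 \<le> v x" using v0 by simp
    fix \<epsilon> :: real and m n :: nat assume \<epsilon>: "0 < \<epsilon>"
    have H: "(\<lambda>x. compromise \<epsilon> (\<phi> m x) (\<phi> n x)) \<in> C_delta"
      by (rule test_functions_compromise[OF \<epsilon> \<phi> \<phi>])
    show "integrable half_measure (\<lambda>x. f x * compromise \<epsilon> (\<phi> m x) (\<phi> n x))"
      by (rule weak(1)[OF H])
    show "(\<integral>x. \<rho> x * norm (G x) powr (p - 2) * (G x \<bullet> (compromise_s \<epsilon> (\<phi> m x) (\<phi> n x) *\<^sub>R grad (\<phi> m) x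
          + compromise_t \<epsilon> (\<phi> m x) (\<phi> n x) *\<^sub>R grad (\<phi> n) x)) \<partial>half_measure) =
      (\<integral>x. f x * compromise \<epsilon> (\<phi> m x) (\<phi> n x) \<partial>half_measure)"
      using weak(2)[OF H] by (simp add: grad_compromise[OF \<epsilon> test_functions_D(2)[OF \<phi>] test_functions_D(2)[OF \<phi>]])
  qed
  define c where "c = hardy_const p \<gamma> powr (- p) / \<rho>0"
  have c: "0 \<le> c" using \<rho>0 by (simp add: c_def)
  have "?V \<le> c * ?J"
    using E_hardy[OF p \<gamma> \<rho> \<rho>0 rho_lower E] by (simp add: v_def[abs_def] c_def)
  also have "\<dots> \<le> c * ((\<mu> * b0) * ?V)"
    using J c by (rule mult_left_mono)
  also have "\<dots> = (\<mu> * (b0 * c)) * ?V"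
    by simp
  finally have le: "?V \<le> (\<mu> * (b0 * c)) * ?V" .
  have "\<mu> * (b0 * c) < 1"
    using smallness_imp_less_1[of "q - p" "s - q" "b0 * c" \<Lambda>] small pq qs mult_nonneg_nonneg[OF less_imp_le[OF b0] c]
    by (simp add: \<mu>_def \<Lambda>_def c_def)
  moreover have "0 \<le> ?V"
    using v0 by (intro Bochner_Integration.integral_nonneg) auto
  ultimately have "?V = 0"
    using le mult_strict_right_mono[of "\<mu> * (b0 * c)" 1 ?V] by fastforce
  then have "AE x in half_measure. v x = 0"
    using integral_nonneg_eq_0_iff_AE[OF iv] v0 by simp
  then show ?thesis
    using sp by eventually_elim (auto simp: v_def half_space_def)
qed

section \<open>The trivial solution\<close>

text \<open>Completeness of \<open>lebesgue\<close> makes a function that vanishes almost everywhere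
  measurable.\<close>

lemma AE_zero_integrable:
  fixes f :: "'a::euclidean_space \<Rightarrow> 'b::euclidean_space"
  assumes "S \<in> sets lebesgue" "AE x in lebesgue_on S. f x = 0"
  shows "integrable (lebesgue_on S) f"
proof -
  have ae: "AE x in lebesgue. 0 = indicator S x *\<^sub>R f x"
    using assms by (subst (asm) AE_restrict_space_iff) (auto elim!: eventually_mono simp: indicator_def)
  have "integrable lebesgue (\<lambda>x. indicator S x *\<^sub>R f x)"
    by (rule integrable_cong_AE_imp[of _ "\<lambda>x. 0"])
       (use ae borel_measurable_AE[OF _ ae] in \<open>auto elim: eventually_mono\<close>)
  then show ?thesis
    using assms(1) by (simp add: integrable_restrict_space)
qed

text \<open>Functions are not identified when equal almost everywhere, so \<open>u\<close> may be
  nonzero on a null set. The gradient \<open>0\<close> and the zero sequence of test functions are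
  the witnesses, and integrands that vanish with \<open>u\<close> integrate to
  \<open>0\<close>.\<close>

lemma zero_weak_solution:
  fixes u :: "'m::finite space_N \<Rightarrow> real"
  assumes p: "1 < p" and u: "AE x in half_measure. u x = 0"
  shows "weak_solution p q s \<gamma> \<rho> a b u"
proof -
  have grad0: "grad (\<lambda>x::'m space_N. 0) = (\<lambda>x. 0)"
    using grad_eqI[of "\<lambda>x::'m space_N. 0" "\<lambda>x. 0"] by (auto simp: fun_eq_iff)
  have C0: "(\<lambda>x. 0) \<in> (C_delta :: ('m space_N \<Rightarrow> real) set)"
    by (simp add: test_functions_def times_cont_differentiable_const)
  have null: "integrable half_measure g" "integral\<^sup>L half_measure g = 0"
    if "\<And>x. u x = 0 \<Longrightarrow> g x = 0" for g :: "'m space_N \<Rightarrow> real"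
  proof -
    have "AE x in half_measure. g x = 0"
      using u by eventually_elim (rule that)
    then show "integrable half_measure g" "integral\<^sup>L half_measure g = 0"
      by (auto intro: AE_zero_integrable integral_eq_zero_AE)
  qed
  have loc_u: "locally_integrable_on half_space u"
    unfolding locally_integrable_on_def set_integrable_def
  proof (intro allI impI)
    fix K :: "'m space_N set" assume K: "compact K \<and> K \<subseteq> half_space"
    then have "K \<in> sets borel" by (auto intro: borel_compact)
    then have KS: "K \<in> sets lebesgue" by auto
    have "AE x in lebesgue. x \<in> half_space \<longrightarrow> u x = 0"
      using u by (subst (asm) AE_restrict_space_iff) auto
    then have "AE x in lebesgue. x \<in> K \<longrightarrow> u x = 0"
      by eventually_elim (use K in blast)
    then have "integrable (lebesgue_on K) u"
      using KS by (intro AE_zero_integrable) (auto simp: AE_restrict_space_iff)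
    then show "integrable lebesgue (\<lambda>x. indicator K x *\<^sub>R u x)"
      using KS by (simp add: integrable_restrict_space)
  qed
  have loc_0: "locally_integrable_on half_space (\<lambda>x. 0 :: 'm space_N)"
    by (simp add: locally_integrable_on_def set_integrable_def)
  have "in_E_with_gradient p \<gamma> \<rho> u (\<lambda>x. 0)"
    unfolding in_E_with_gradient_def
  proof (intro conjI exI[of _ "\<lambda>n x. 0"])
    show "u \<in> Lp_weighted p (\<lambda>x. (1 + snd x) powr (\<gamma> - p))"
      unfolding Lp_weighted_def using null(1)[of u] null(1)[of "\<lambda>x. (1 + snd x) powr (\<gamma> - p) * norm (u x) powr p"] p
      by auto
    show "has_weak_gradient u (\<lambda>x. 0)"
      unfolding has_weak_gradient_def using loc_u loc_0 null(2) by simp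
    show "(\<lambda>n. Lp_norm p (\<lambda>x. (1 + snd x) powr (\<gamma> - p)) (\<lambda>x. 0 - u x)) \<longlonglongrightarrow> 0"
      unfolding Lp_norm_def using null(2)[of "\<lambda>x. (1 + snd x) powr (\<gamma> - p) * norm (0 - u x) powr p"] p by simp
  qed (use C0 p in \<open>auto simp: Lp_weighted_def Lp_norm_def grad0\<close>)
  moreover have "integrable half_measure (\<lambda>x. (a x * \<bar>u x\<bar> powr (q - 2) * u x - b x * \<bar>u x\<bar> powr (s - 2) * u x) * \<phi> x)"
      "(\<integral>x. (a x * \<bar>u x\<bar> powr (q - 2) * u x - b x * \<bar>u x\<bar> powr (s - 2) * u x) * \<phi> x \<partial>half_measure) = 0" for \<phi>
    by (intro null; simp)+
  ultimately show ?thesis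
    unfolding weak_solution_def by (intro exI[of _ "\<lambda>x. 0"]) simp
qed

theorem theorem2p3:
  fixes \<rho> a b :: "('m::finite) space_N \<Rightarrow> real"
    and p q s \<gamma> \<rho>0 b0 :: real
    and N :: nat
  assumes N: "N = DIM('m space_N)"
    and exponents:
      "(1 < p \<and> p < real N \<and> p < q \<and> q < s \<and> s \<le> real N * p / (real N - p)) \<or>
       (p = real N \<and> N \<ge> 2 \<and> p < q \<and> q < s)"
    and weights: "admissible_weight \<rho>" "admissible_weight a" "admissible_weight b"
    and "\<rho>0 > 0" and "\<gamma> > p - 1"
    and rho_lower: "AE x in half_measure. \<rho> x \<ge> \<rho>0 * (1 + snd x) powr \<gamma>"
    and b_in: "b \<in> K_b p \<gamma>"
    and "b0 > 0"
    and b_upper: "\<And>x. x \<in> half_space \<Longrightarrow> b x * (1 + snd x) powr (p - \<gamma>) \<le> b0"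
    and ab_in: "(\<lambda>x. a x / b x) \<in> Linf"
    and small:
      "Linf_norm (\<lambda>x. a x / b x) powr (s - p) *
         (b0 * hardy_const p \<gamma> powr (- p) / \<rho>0) powr (s - q)
       < (s - p) powr (s - p) / ((q - p) powr (q - p) * (s - q) powr (s - q))"
  shows "\<forall>u. weak_solution p q s \<gamma> \<rho> a b u \<longleftrightarrow> (AE x in half_measure. u x = 0)"
proof (intro allI iffI)
  \<comment> \<open>In the borderline case \<open>p = N\<close> the strict bound comes from
    \<open>N \<ge> 2\<close>.\<close>
  have p: "1 < p" and "p < q" "q < s"
    using exponents by auto
  fix u
  show "AE x in half_measure. u x = 0" if "weak_solution p q s \<gamma> \<rho> a b u"
    by (rule weak_solution_imp_zero[OF p \<open>p < q\<close> \<open>q < s\<close> weights(1,3) \<open>\<rho>0 > 0\<close> \<open>\<gamma> > p - 1\<close>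
          rho_lower \<open>b0 > 0\<close> b_upper ab_in small that])
  show "weak_solution p q s \<gamma> \<rho> a b u" if "AE x in half_measure. u x = 0"
    by (rule zero_weak_solution[OF p that])
qed

end
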